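(* Let $\psi:\mathbb{R}\times\mathbb{R}^k\to\mathbb{R}^k$ be continuously differentiable and $T$-periodic in $t$, let $U\subset\mathbb{R}^k$ be open and bounded, and assume (A0): $\Omega(T,0,\xi)=\xi$ for all $\xi\in\partial U$. Let $\phi_1,\phi_2:\mathbb{R}\times\mathbb{R}^k\to\mathbb{R}^k$ be continuously differentiable and $T$-periodic in $t$, and for $\lambda\in[0,1]$ put $\phi_\lambda=\lambda\phi_1+(1-\lambda)\phi_2$. Let $\eta_\lambda(\cdot,s,\xi)$ denote the solution of $$\dot y=\phi_\lambda(t,\Omega(t,0,\xi))+\psi'_{x}(t,\Omega(t,0,\xi))\,y,\qquad y(s)=0.$$ Assume that for every $\lambda\in[0,1]$, $\eta_\lambda(T,s,\xi)-\eta_\lambda(0,s,\xi)\neq0$ for all $s\in[0,T]$, $\xi\in\partial U$. Then $\gamma(\eta_1(T,0,\cdot),U)=\gamma(\eta_2(T,0,\cdot),U)$ (where $\eta_1,\eta_2$ correspond to $\lambda=1$, i.e. $\phi_1$, and $\lambda=0$, i.e. $\phi_2$, respectively).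
   Context: Standing assumption: solutions of $\dot x=\psi(t,x)$ exist for all times. $\Omega(\cdot,t_0,\xi)$ denotes the solution of $\dot x=\psi(t,x)$ with $x(t_0)=\xi$. $\psi'_x$ is the Jacobian matrix of $\psi$ with respect to its spatial variable. For a continuous map $F:\bar U\to\mathbb{R}^k$ on the closure of a bounded open set $U$ with $F\neq0$ on $\partial U$, $\gamma(F,U)$ denotes the rotation number (Brouwer degree $\deg(F,U,0)$) of the vector field $F$. *)

theory Defs
  imports "HOL-Analysis.Analysis"
begin

definition C1_map :: "('a::real_normed_vector \<Rightarrow> 'b::real_normed_vector) \<Rightarrow> bool" where
  "C1_map f \<longleftrightarrow> (\<exists>f'. (\<forall>z. (f has_derivative blinfun_apply (f' z)) (at z)) \<and> continuous_on UNIV f')"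

definition regular_approx ::
  "(real^'n \<Rightarrow> real^'n) \<Rightarrow> (real^'n \<Rightarrow> real^'n) \<Rightarrow> (real^'n) set \<Rightarrow> real \<Rightarrow> bool" where
  "regular_approx G F U \<delta> \<longleftrightarrow>
     continuous_on (closure U) G \<and>
     (\<forall>x\<in>U. G differentiable (at x)) \<and>
     continuous_on U (\<lambda>x. jacobian G (at x)) \<and>
     (\<forall>x\<in>closure U. norm (G x - F x) < \<delta>) \<and>
     (\<forall>x\<in>U. G x = 0 \<longrightarrow> det (jacobian G (at x)) \<noteq> 0)"

definition regular_degree :: "(real^'n \<Rightarrow> real^'n) \<Rightarrow> (real^'n) set \<Rightarrow> int" where
  "regular_degree G U =
     (\<Sum>x\<in>{x\<in>U. G x = 0}. if det (jacobian G (at x)) > 0 then 1 else -1)"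

definition brouwer_degree :: "(real^'n \<Rightarrow> real^'n) \<Rightarrow> (real^'n) set \<Rightarrow> int" where
  "brouwer_degree F U =
     (THE d. \<exists>\<delta>>0. \<forall>G. regular_approx G F U \<delta> \<longrightarrow> regular_degree G U = d)"

end

theory Submission
  imports Defs
begin

text \<open>By uniqueness for the linear equation, \<open>\<eta> lam T 0\<close> is the affine combination of
  \<open>\<eta> 0 T 0\<close> and \<open>\<eta> 1 T 0\<close>, these are continuous in the initial value by Gronwall estimates, and
  \<open>\<eta> lam 0 0 = 0\<close>; so at \<open>s = 0\<close> the hypothesis provides a linear homotopy without zeros on the frontier.

  Homotopy invariance of the degree is proved analytically. For a \<open>C\<^sup>2\<close> field \<open>P\<close> and a product bump kernel
  \<open>\<rho>\<close>, the integral of \<open>\<rho>(P/e) det D(P/e)\<close> over \<open>U\<close> does not change along small perturbations, because the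
  integrand is a null Lagrangian. It counts the zeros of a nondegenerate field \<open>G\<close> close to \<open>P\<close> with
  sign: near each zero \<open>P\<close> is homotopic to the linearisation of \<open>G\<close>, and the integral of a linear map is the sign
  of its determinant times a constant. Stone-Weierstrass provides \<open>P\<close>, and Sard's theorem shows that
  regular approximations exist, so that the definite description defining the degree is well-determined.\<close>

subsection \<open>Twice continuously differentiable functions\<close>

text \<open>The product form of the kernel shapes the argument. If \<open>F\<close> is an
  antiderivative of \<open>bump\<close>, the kernel of \<open>P\<close> is the Jacobian determinant
  of the map with components \<open>F (P x $ j)\<close>. Two fields can therefore be compared by
  exchanging one component at a time, each exchange leaving an exact divergence, and a homotopy is
  handled as finitely many small jumps. A regular approximation \<open>G\<close> is controlled only
  to first order and only inside the open set, whereas the divergence identity uses second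
  derivatives. Hence the integral is evaluated on a polynomial \<open>P\<close> near
  \<open>G\<close>. The zeros of \<open>P\<close> may be degenerate and need not correspond to those
  of \<open>G\<close>, which is why \<open>P\<close> is compared with an affine map on a small ball
  about each zero of \<open>G\<close>. The value for linear maps comes from row operations. For the
  differential equation, \<open>\<psi>\<close> is Lipschitz only on compact sets. The Gronwall
  estimates are therefore conditional on staying within distance 1 of a reference solution, and a
  continuation argument removes the condition.\<close>

definition grad :: "'n \<Rightarrow> (real^'n \<Rightarrow> real) \<Rightarrow> real^'n \<Rightarrow> real" where
  "grad a u x = frechet_derivative u (at x) (axis a 1)"

text \<open>Symmetry of the mixed second derivatives is a clause of its own: the closure lemmas
  propagate it from constants and linear maps to polynomials, and it makes the second-order terms
  cancel in \<open>det_grad_eq_divergence\<close>.\<close>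

definition C2 :: "(real^'n \<Rightarrow> real) \<Rightarrow> bool" where
  "C2 u \<longleftrightarrow> (\<forall>x. u differentiable (at x)) \<and> (\<forall>a x. grad a u differentiable (at x)) \<and>
    (\<forall>a b. grad a (grad b u) = grad b (grad a u)) \<and> (\<forall>a b. continuous_on UNIV (grad a (grad b u)))"

lemma linear_sum_axis:
  fixes f :: "real^'n \<Rightarrow> real"
  assumes "linear f"
  shows "f h = (\<Sum>a\<in>UNIV. f (axis a 1) * h $ a)"
proof -
  have "f h = f (\<Sum>a\<in>UNIV. (h $ a) *\<^sub>R axis a 1)"
    using basis_expansion[of h] by (simp add: scalar_mult_eq_scaleR)
  also have "\<dots> = (\<Sum>a\<in>UNIV. f (axis a 1) * h $ a)"
    using assms by (simp add: linear_sum linear_cmul mult.commute)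
  finally show ?thesis .
qed

lemma grad_eqI:
  assumes "(u has_derivative D) (at x)"
  shows "grad a u x = D (axis a 1)"
  using frechet_derivative_at[OF assms] by (simp add: grad_def)

lemma has_derivative_grad:
  assumes "u differentiable (at x)"
  shows "(u has_derivative (\<lambda>h. \<Sum>a\<in>UNIV. grad a u x * h $ a)) (at x)"
proof -
  have *: "(u has_derivative frechet_derivative u (at x)) (at x)"
    using assms frechet_derivative_works by blast
  then have "frechet_derivative u (at x) = (\<lambda>h. \<Sum>a\<in>UNIV. grad a u x * h $ a)"
    unfolding grad_def using linear_sum_axis has_derivative_linear by blast
  with * show ?thesis by metis
qed

lemma grad_const: "grad a (\<lambda>x. c) = (\<lambda>x. 0)"
  by (rule ext, subst grad_eqI[where D="\<lambda>h. 0"]) auto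

lemma grad_linear: "bounded_linear f \<Longrightarrow> grad a f = (\<lambda>x. f (axis a 1))"
  by (rule ext, subst grad_eqI[where D=f]) (auto intro: bounded_linear.has_derivative)

lemma grad_add:
  assumes "u differentiable (at x)" "v differentiable (at x)"
  shows "grad a (\<lambda>x. u x + v x) x = grad a u x + grad a v x"
  by (subst grad_eqI[OF has_derivative_add[OF has_derivative_grad[OF assms(1)] has_derivative_grad[OF assms(2)]]])
    (simp add: axis_def if_distrib cong: if_cong)

lemma grad_diff:
  assumes "u differentiable (at x)" "v differentiable (at x)"
  shows "grad a (\<lambda>x. u x - v x) x = grad a u x - grad a v x"
  by (subst grad_eqI[OF has_derivative_diff[OF has_derivative_grad[OF assms(1)] has_derivative_grad[OF assms(2)]]])
    (simp add: axis_def if_distrib cong: if_cong)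

lemma grad_mult:
  assumes "u differentiable (at x)" "v differentiable (at x)"
  shows "grad a (\<lambda>x. u x * v x) x = u x * grad a v x + grad a u x * v x"
  by (subst grad_eqI[OF has_derivative_mult[OF has_derivative_grad[OF assms(1)] has_derivative_grad[OF assms(2)]]])
    (simp add: axis_def if_distrib cong: if_cong)

lemma grad_compose:
  assumes "u differentiable (at x)" "(F has_real_derivative d) (at (u x))"
  shows "grad a (\<lambda>x. F (u x)) x = d * grad a u x"
  by (subst grad_eqI[OF has_derivative_compose[OF has_derivative_grad[OF assms(1)]
        assms(2)[unfolded has_field_derivative_def]]])
    (simp add: axis_def if_distrib cong: if_cong)

lemma differentiable_imp_continuous_on: "(\<And>x. u differentiable (at x)) \<Longrightarrow> continuous_on UNIV u"
  by (simp add: differentiable_imp_continuous_within continuous_on_eq_continuous_at)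

lemma C2_const: "C2 (\<lambda>x. c)"
  by (simp add: C2_def grad_const)

lemma C2_linear: "bounded_linear f \<Longrightarrow> C2 f"
  by (simp add: C2_def grad_linear grad_const bounded_linear_imp_differentiable)

lemma C2D:
  assumes "C2 u"
  shows "u differentiable (at x)" "grad a u differentiable (at x)"
    "grad a (grad b u) x = grad b (grad a u) x" "continuous_on UNIV u" "continuous_on UNIV (grad a u)"
    "continuous_on UNIV (grad a (grad b u))"
  using assms by (auto simp: C2_def intro: differentiable_imp_continuous_on)

lemma C2_add:
  assumes "C2 u" "C2 v"
  shows "C2 (\<lambda>x. u x + v x)"
proof -
  have 1: "grad a (\<lambda>x. u x + v x) = (\<lambda>x. grad a u x + grad a v x)" for a
    using assms by (auto simp: grad_add C2D)
  have 2: "grad b (\<lambda>x. grad a u x + grad a v x) = (\<lambda>x. grad b (grad a u) x + grad b (grad a v) x)" for a b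
    using assms by (auto simp: grad_add C2D)
  show ?thesis
    unfolding C2_def 1 2 using assms by (auto simp: C2D intro!: derivative_intros continuous_intros)
qed

lemma C2_mult:
  assumes "C2 u" "C2 v"
  shows "C2 (\<lambda>x. u x * v x)"
proof -
  have 1: "grad a (\<lambda>x. u x * v x) = (\<lambda>x. u x * grad a v x + grad a u x * v x)" for a
    using assms by (auto simp: grad_mult C2D)
  have 2: "grad b (\<lambda>x. u x * grad a v x + grad a u x * v x) =
      (\<lambda>x. u x * grad b (grad a v) x + grad b u x * grad a v x + (grad a u x * grad b v x + grad b (grad a u) x * v x))" for a b
    using assms by (auto simp: grad_add grad_mult C2D)
  show ?thesis
    unfolding C2_def 1 2 using assms by (auto simp: C2D fun_eq_iff intro!: derivative_intros continuous_intros)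
qed

lemma C2_cmult: "C2 u \<Longrightarrow> C2 (\<lambda>x. c * u x)"
  by (rule C2_mult[OF C2_const])

lemma C2_diff: "C2 u \<Longrightarrow> C2 v \<Longrightarrow> C2 (\<lambda>x. u x - v x)"
  using C2_add[OF _ C2_cmult[of v "-1"], of u] by simp

lemma C2_compose:
  assumes u: "C2 u" and F: "\<And>s. (F has_real_derivative g s) (at s)" "\<And>s. (g has_real_derivative g' s) (at s)"
    and g': "continuous_on UNIV g'"
  shows "C2 (\<lambda>x. F (u x))"
proof -
  have d: "(\<lambda>x. F (u x)) differentiable (at x)" "(\<lambda>x. g (u x)) differentiable (at x)" for x
    using differentiable_chain_at[of u x F] differentiable_chain_at[of u x g] C2D(1)[OF u] F
    by (force simp: o_def real_differentiable_def)+
  have 1: "grad a (\<lambda>x. F (u x)) = (\<lambda>x. g (u x) * grad a u x)" for a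
    using grad_compose[OF C2D(1)[OF u] F(1)] by auto
  have 2: "grad b (\<lambda>x. g (u x) * grad a u x) =
     (\<lambda>x. g (u x) * grad b (grad a u) x + g' (u x) * grad b u x * grad a u x)" for a b
    using grad_compose[OF C2D(1)[OF u] F(2)] d u by (auto simp: grad_mult C2D)
  have 3: "continuous_on UNIV (\<lambda>x. g' (u x))" "continuous_on UNIV (\<lambda>x. g (u x))"
    using continuous_on_compose2[OF g' C2D(4)[OF u]] differentiable_imp_continuous_on d by auto
  show ?thesis
    unfolding C2_def 1 2 using u d 3 by (auto simp: C2D fun_eq_iff intro!: derivative_intros continuous_intros)
qed

lemma C2_polynomial: "real_polynomial_function p \<Longrightarrow> C2 p"
  by (induction rule: real_polynomial_function.induct) (auto intro: C2_linear C2_const C2_add C2_mult)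

lemma C2_polynomial_component: "polynomial_function p \<Longrightarrow> C2 (\<lambda>x. p x $ j)"
  unfolding polynomial_function_def using C2_polynomial bounded_linear_vec_nth by (force simp: o_def)

subsection \<open>A bump function\<close>

text \<open>The outer square makes the derivative continuous, so that an antiderivative is twice
  continuously differentiable, as \<open>C2_compose\<close> demands. The support is [-1,1]; evenness
  makes the kernel insensitive to sign changes of a component, up to the determinant.\<close>

definition bump :: "real \<Rightarrow> real" where "bump s = (max 0 (1 - s\<^sup>2))\<^sup>2"

lemma max0_power2_has_derivative: "((\<lambda>y. (max 0 y)\<^sup>2) has_real_derivative 2 * max 0 y) (at (y::real))"
proof -
  consider "y < 0" | "y = 0" | "y > 0" by linarith
  then show ?thesis
  proof cases
    case 1
    have "((\<lambda>y. 0) has_real_derivative 0) (at y)" by simp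
    then have "((\<lambda>y. (max 0 y)\<^sup>2) has_real_derivative 0) (at y)"
      using 1 by (elim has_field_derivative_transform_within_open[where S="{..<0}"]) auto
    then show ?thesis using 1 by simp
  next
    case 2
    have "((\<lambda>h::real. (max 0 h)\<^sup>2 / h) \<longlongrightarrow> 0) (at 0)"
    proof (rule Lim_null_comparison)
      show "\<forall>\<^sub>F h in at 0. norm ((max 0 h)\<^sup>2 / h) \<le> \<bar>h\<bar>"
        by (rule always_eventually) (auto simp: max_def power2_eq_square)
      show "((\<lambda>h::real. \<bar>h\<bar>) \<longlongrightarrow> 0) (at 0)"
        using tendsto_rabs[OF tendsto_ident_at, of 0 UNIV] by simp
    qed
    then show ?thesis using 2 by (simp add: DERIV_def)
  next
    case 3
    have "((\<lambda>y. y\<^sup>2) has_real_derivative 2 * y) (at y)" by (auto intro!: derivative_eq_intros)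
    then have "((\<lambda>y. (max 0 y)\<^sup>2) has_real_derivative 2 * y) (at y)"
      using 3 by (elim has_field_derivative_transform_within_open[where S="{0<..}"]) auto
    then show ?thesis using 3 by simp
  qed
qed

lemma bump_has_derivative: "(bump has_real_derivative - (4 * s * max 0 (1 - s\<^sup>2))) (at s)"
proof -
  have "((\<lambda>s. 1 - s\<^sup>2) has_real_derivative - (2 * s)) (at s)"
    by (auto intro!: derivative_eq_intros)
  from DERIV_chain2[OF max0_power2_has_derivative this] show ?thesis
    by (simp add: bump_def[abs_def] algebra_simps)
qed

lemma bump_nonneg: "bump s \<ge> 0" and bump_0: "bump 0 = 1" and bump_minus: "bump (- s) = bump s"
  by (auto simp: bump_def)

lemma bump_eq_0: "\<bar>s\<bar> \<ge> 1 \<Longrightarrow> bump s = 0"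
  using abs_square_le_1[of s] by (auto simp: bump_def max_def) (metis abs_le_square_iff abs_one le_less not_le one_power2)

lemma continuous_on_bump: "continuous_on S bump"
  by (auto simp: bump_def[abs_def] intro!: continuous_intros)

text \<open>The two ends of the line carry different constants, so \<open>F\<close> identifies two
  values beyond the support only if they lie on the same side. This is the origin of the sign
  conditions in the homotopy lemmas.\<close>

lemma bump_antiderivative:
  obtains F where "\<And>s. (F has_real_derivative bump s) (at s)"
    "\<And>s t. s > 1 \<Longrightarrow> t > 1 \<Longrightarrow> F s = F t" "\<And>s t. s < -1 \<Longrightarrow> t < -1 \<Longrightarrow> F s = F t"
proof -
  define F where "F = (\<lambda>t. LBINT s=0..ereal t. bump s)"
  have F: "(F has_real_derivative bump s) (at s)" for s
  proof -
    \<comment> \<open>The interval contains the base point 0 and has \<open>s\<close> in its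
      interior, which makes the derivative two-sided.\<close>
    have "(F has_vector_derivative bump s) (at s within {-\<bar>s\<bar>-1..\<bar>s\<bar>+1})"
      unfolding F_def zero_ereal_def
      by (rule interval_integral_FTC2) (auto intro: continuous_on_bump)
    moreover have "at s within {-\<bar>s\<bar>-1..\<bar>s\<bar>+1} = at s"
      by (rule at_within_interior) auto
    ultimately show ?thesis
      by (simp add: has_real_derivative_iff_has_vector_derivative)
  qed
  have *: "F s = F t" if "convex S" "s \<in> S" "t \<in> S" "\<And>x. x \<in> S \<Longrightarrow> bump x = 0" for S s t
  proof -
    have "\<exists>c. \<forall>x\<in>S. F x = c"
      by (rule has_field_derivative_zero_constant) (use that in auto, metis F that(4) has_field_derivative_at_within)
    with that show ?thesis by auto
  qed
  show ?thesis
  proof (rule that[OF F])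
    show "F s = F t" if "s > 1" "t > 1" for s t
      by (rule *[of "{1<..}"]) (use that in \<open>auto intro: bump_eq_0\<close>)
    show "F s = F t" if "s < -1" "t < -1" for s t
      by (rule *[of "{..<-1}"]) (use that in \<open>auto intro: bump_eq_0\<close>)
  qed
qed

subsection \<open>The Jacobian determinant as a null Lagrangian\<close>

text \<open>Translation invariance of \<open>lborel\<close> makes the integral of every difference
  quotient of \<open>W\<close> in direction \<open>e\<close> vanish; dominated convergence carries
  this over to the derivative.\<close>

lemma integral_derivative_compact_support:
  fixes W :: "'a::euclidean_space \<Rightarrow> real"
  assumes K: "compact K" and W0: "\<And>x. x \<notin> K \<Longrightarrow> W x = 0"
    and der: "\<And>x. (W has_derivative W' x) (at x)" and cont: "continuous_on UNIV (\<lambda>x. W' x e)"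
  shows "(\<integral>x. W' x e \<partial>lborel) = 0"
proof -
  obtain R where R: "R > 0" "K \<subseteq> ball 0 R"
    using bounded_subset_ballD[OF compact_imp_bounded[OF K]] by metis
  have W'0: "W' x e = 0" if "x \<notin> K" for x
  proof -
    have "open (- K)" using K by (simp add: compact_imp_closed open_Compl)
    then have "((\<lambda>x. 0) has_derivative W' x) (at x)"
      by (rule has_derivative_transform_within_open[OF der]) (use that W0 in auto)
    then have "W' x = (\<lambda>h. 0)"
      using has_derivative_unique has_derivative_const by blast
    then show ?thesis by simp
  qed
  obtain M where M: "\<And>x. x \<in> K \<Longrightarrow> \<bar>W' x e\<bar> \<le> M"
    using compact_imp_bounded[OF compact_continuous_image[OF continuous_on_subset[OF cont subset_UNIV] K]]
    by (auto simp: bounded_iff)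
  have M: "\<bar>W' x e\<bar> \<le> max M 0" for x
    using M[of x] W'0[of x] by (cases "x \<in> K") auto
  let ?c = "\<lambda>n. 1 / real (Suc n)"
  have contW: "continuous_on UNIV W"
    by (simp add: continuous_on_eq_continuous_at has_derivative_continuous[OF der])
  have intW: "integrable lborel W"
  proof -
    have "integrable lborel (\<lambda>x. indicator K x *\<^sub>R W x)"
      by (rule borel_integrable_compact) (use K contW continuous_on_subset in blast)+
    moreover have "(\<lambda>x. indicator K x *\<^sub>R W x) = W"
      using W0 by (intro ext) (auto simp: indicator_def)
    ultimately show ?thesis by simp
  qed
  have [measurable]: "W \<in> borel_measurable borel"
    using contW by (rule borel_measurable_continuous_onI)
  have shift: "integrable lborel (\<lambda>x. W (c + x))" "(\<integral>x. W (c + x) \<partial>lborel) = (\<integral>x. W x \<partial>lborel)" for c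
  proof -
    have "integrable (distr lborel borel ((+) c)) W" using intW by (simp add: lborel_distr_plus)
    then show "integrable lborel (\<lambda>x. W (c + x))" by (subst (asm) integrable_distr_eq) auto
    have "(\<integral>x. W x \<partial>lborel) = (\<integral>x. W x \<partial>distr lborel borel ((+) c))" by (simp add: lborel_distr_plus)
    also have "\<dots> = (\<integral>x. W (c + x) \<partial>lborel)" by (rule integral_distr) auto
    finally show "(\<integral>x. W (c + x) \<partial>lborel) = (\<integral>x. W x \<partial>lborel)" by simp
  qed
  define s where "s n x = (W (?c n *\<^sub>R e + x) - W x) / ?c n" for n x
  have s0: "(\<integral>x. s n x \<partial>lborel) = 0" for n
    unfolding s_def using shift[of "?c n *\<^sub>R e"] intW by simp
  have line: "((\<lambda>t. W (t *\<^sub>R e + x)) has_real_derivative W' (t *\<^sub>R e + x) e) (at t)" for t x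
  proof -
    have "((\<lambda>t. t *\<^sub>R e + x) has_derivative (\<lambda>h. h *\<^sub>R e)) (at t)"
      by (auto intro!: derivative_eq_intros)
    from has_derivative_compose[OF this der] show ?thesis
      unfolding has_field_derivative_def
      by (rule has_derivative_eq_rhs) (auto simp: linear_cmul[OF has_derivative_linear[OF der]] mult.commute)
  qed
  have "(\<lambda>n. \<integral>x. s n x \<partial>lborel) \<longlonglongrightarrow> (\<integral>x. W' x e \<partial>lborel)"
  proof (rule integral_dominated_convergence)
    show "(\<lambda>x. W' x e) \<in> borel_measurable lborel"
      using cont borel_measurable_continuous_onI by auto
    show "s n \<in> borel_measurable lborel" for n
      unfolding s_def by measurable
    \<comment> \<open>The shifts are at most \<open>norm e\<close> long, so all quotients vanish
      outside the ball of radius \<open>R + norm e\<close>; inside, the mean value theorem bounds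
      them by \<open>max M 0\<close>.\<close>
    show "integrable lborel (\<lambda>x. max M 0 * indicator (cball (0::'a) (R + norm e)) x :: real)"
      by (auto intro!: integrable_real_indicator emeasure_bounded_finite)
    show "AE x in lborel. (\<lambda>n. s n x) \<longlonglongrightarrow> W' x e"
    proof (rule AE_I2)
      fix x
      have "((\<lambda>h. (W (h *\<^sub>R e + x) - W x) / h) \<longlongrightarrow> W' x e) (at 0)"
        using line[of x 0] by (simp add: DERIV_def)
      moreover have "filterlim ?c (at 0) sequentially"
        unfolding filterlim_at using lim_const_over_n[of 1] LIMSEQ_inverse_real_of_nat
        by (auto simp: inverse_eq_divide)
      ultimately show "(\<lambda>n. s n x) \<longlonglongrightarrow> W' x e"
        unfolding s_def using filterlim_compose[of "\<lambda>h. (W (h *\<^sub>R e + x) - W x) / h" _ "at 0" ?c sequentially] by blast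
    qed
    show "AE x in lborel. norm (s n x) \<le> max M 0 * indicator (cball 0 (R + norm e)) x" for n
    proof (rule AE_I2)
      fix x
      have c: "0 < ?c n" "?c n \<le> 1" by auto
      show "norm (s n x) \<le> max M 0 * indicator (cball 0 (R + norm e)) x"
      proof (cases "x \<in> cball 0 (R + norm e)")
        case True
        obtain z where "W (?c n *\<^sub>R e + x) - W (0 *\<^sub>R e + x) = (?c n - 0) * W' (z *\<^sub>R e + x) e"
          using MVT2[of 0 "?c n" "\<lambda>t. W (t *\<^sub>R e + x)" "\<lambda>t. W' (t *\<^sub>R e + x) e"] c line by auto
        then have "s n x = W' (z *\<^sub>R e + x) e"
          unfolding s_def by simp
        then show ?thesis using M True by simp
      next
        case False
        have "norm x \<le> norm (?c n *\<^sub>R e + x) + norm (?c n *\<^sub>R e)"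
          by (metis add_diff_cancel_left' norm_triangle_ineq4 add.commute)
        moreover have "norm (?c n *\<^sub>R e) \<le> norm e"
          using mult_right_mono[OF c(2) norm_ge_zero[of e]] by simp
        moreover have "norm x > R + norm e" using False by simp
        moreover have "z \<notin> K" if "norm z \<ge> R" for z
          using that R(2) by (auto simp: subset_iff)
        ultimately have "x \<notin> K" "?c n *\<^sub>R e + x \<notin> K"
          using norm_ge_zero[of e] by (smt (verit))+
        then show ?thesis unfolding s_def using W0 by simp
      qed
    qed
  qed
  then show ?thesis by (auto simp: s0 LIMSEQ_const_iff)
qed

lemma differentiable_cutoff:
  assumes "open V" "compact K" "K \<subseteq> V" and w: "\<And>x. w differentiable (at x)" "\<And>x. x \<in> V - K \<Longrightarrow> w x = (0::real)"
  shows "(\<lambda>x. if x \<in> V then w x else 0) differentiable (at x)"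
    and "grad a (\<lambda>x. if x \<in> V then w x else 0) x = (if x \<in> V then grad a w x else 0)"
proof -
  let ?D = "\<lambda>h. \<Sum>a\<in>UNIV. (if x \<in> V then grad a w x else 0) * h $ a"
  have *: "((\<lambda>x. if x \<in> V then w x else 0) has_derivative ?D) (at x)"
  proof (cases "x \<in> V")
    case True
    then show ?thesis
      using has_derivative_transform_within_open[OF has_derivative_grad[OF w(1)] assms(1),
          where g="\<lambda>x. if x \<in> V then w x else 0"] by simp
  next
    case False
    have "open (- K)" using assms by (simp add: compact_imp_closed open_Compl)
    then have "((\<lambda>x. if x \<in> V then w x else 0) has_derivative (\<lambda>h. 0)) (at x)"
      by (rule has_derivative_transform_within_open[OF has_derivative_const[of 0]])
        (use False \<open>K \<subseteq> V\<close> w(2) in auto)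
    then show ?thesis using False by simp
  qed
  then show "(\<lambda>x. if x \<in> V then w x else 0) differentiable (at x)"
    by (auto simp: differentiable_def)
  show "grad a (\<lambda>x. if x \<in> V then w x else 0) x = (if x \<in> V then grad a w x else 0)"
    by (subst grad_eqI[OF *]) (simp add: axis_def if_distrib cong: if_cong)
qed

text \<open>Since \<open>w\<close> may be nonzero outside \<open>V\<close>, the derivative of its
  cutoff is integrated over the whole space. The open sets \<open>V\<close> and \<open>- K\<close>
  cover the space, and the cutoff equals \<open>w\<close> on the first and 0 on the second, so it
  inherits the regularity of \<open>w\<close>.\<close>

lemma set_integral_grad_compact_support:
  fixes w :: "real^'n \<Rightarrow> real"
  assumes V: "open V" and K: "compact K" "K \<subseteq> V"
    and w: "\<And>x. w differentiable (at x)" "\<And>x. x \<in> V - K \<Longrightarrow> w x = 0"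
    and cont: "continuous_on UNIV (grad a w)"
  shows "(LINT x:V|lborel. grad a w x) = 0"
proof -
  let ?W = "\<lambda>x. if x \<in> V then w x else 0"
  have c: "?W differentiable (at x)" "grad b ?W x = (if x \<in> V then grad b w x else 0)" for x b
    using differentiable_cutoff[of V K w] V K w by auto
  have c2: "grad a ?W = (\<lambda>x. if x \<in> V then grad a w x else 0)"
    by (rule ext) (rule c(2))
  have z: "grad a w x = 0" if "x \<in> V - K" for x
  proof -
    have "open (V - K)" using V K by (simp add: compact_imp_closed open_Diff)
    then have "((\<lambda>x. 0) has_derivative (\<lambda>h. \<Sum>a\<in>UNIV. grad a w x * h $ a)) (at x)"
      by (rule has_derivative_transform_within_open[OF has_derivative_grad[OF w(1)]]) (use that w(2) in auto)
    then have "(\<lambda>h. 0) = (\<lambda>h. \<Sum>a\<in>UNIV. grad a w x * h $ a)"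
      using has_derivative_unique has_derivative_const by blast
    from fun_cong[OF this, of "axis a 1"] show ?thesis
      by (simp add: axis_def if_distrib cong: if_cong)
  qed
  have "continuous_on (V \<union> - K) (\<lambda>x. if x \<in> V then grad a w x else 0)"
  proof (rule continuous_on_open_Un[OF V])
    show "open (-K)" using K by (simp add: compact_imp_closed open_Compl)
    show "continuous_on V (\<lambda>x. if x \<in> V then grad a w x else 0)"
      by (subst continuous_on_cong[OF refl, where g="grad a w"]) (use cont in \<open>auto intro: continuous_on_subset\<close>)
    show "continuous_on (-K) (\<lambda>x. if x \<in> V then grad a w x else 0)"
      by (subst continuous_on_cong[OF refl, where g="\<lambda>x. 0"]) (use z in auto)
  qed
  moreover have "V \<union> - K = UNIV" using K by auto
  ultimately have cont': "continuous_on UNIV (\<lambda>x. if x \<in> V then grad a w x else 0)" by simp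
  have "(\<integral>x. (\<Sum>b\<in>UNIV. grad b ?W x * axis a 1 $ b) \<partial>lborel) = 0"
  proof (rule integral_derivative_compact_support[where e="axis a 1" and K=K and W="?W" and
        W'="\<lambda>x h. \<Sum>b\<in>UNIV. grad b ?W x * h $ b"])
    show "(?W has_derivative (\<lambda>h. \<Sum>b\<in>UNIV. grad b ?W x * h $ b)) (at x)" for x
      by (rule has_derivative_grad[OF c(1)])
      show "continuous_on UNIV (\<lambda>x. \<Sum>b\<in>UNIV. grad b ?W x * axis a 1 $ b)"
      using cont' by (simp add: axis_def if_distrib[of "(*) _"] c2 cong: if_cong)
  qed (use K w(2) in auto)
  moreover have "(\<Sum>b\<in>UNIV. grad b ?W x * axis a 1 $ b) = indicator V x *\<^sub>R grad a w x" for x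
    by (simp add: axis_def if_distrib c(2) indicator_def cong: if_cong)
  ultimately show ?thesis
    by (simp add: set_lebesgue_integral_def)
qed

lemma grad_prod:
  assumes "finite J" "\<And>j. j \<in> J \<Longrightarrow> v j differentiable (at x)"
  shows "(\<lambda>x. \<Prod>j\<in>J. v j x) differentiable (at x)" (is ?d)
    and "grad b (\<lambda>x. \<Prod>j\<in>J. v j x) x = (\<Sum>k\<in>J. grad b (v k) x * (\<Prod>j\<in>J-{k}. v j x))" (is ?g)
proof -
  have *: "((\<lambda>x. \<Prod>j\<in>J. v j x) has_derivative
     (\<lambda>y. \<Sum>i\<in>J. (\<Sum>a\<in>UNIV. grad a (v i) x * y $ a) * (\<Prod>j\<in>J - {i}. v j x))) (at x)"
    by (rule has_derivative_prod) (rule has_derivative_grad[OF assms(2)])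
  then show ?d by (auto simp: differentiable_def)
  show ?g by (subst grad_eqI[OF *]) (simp add: axis_def if_distrib cong: if_cong)
qed

lemma grad_sum_cmult:
  assumes "finite J" "\<And>j. j \<in> J \<Longrightarrow> v j differentiable (at x)"
  shows "(\<lambda>x. \<Sum>j\<in>J. c j * v j x) differentiable (at x)" (is ?d)
    and "grad b (\<lambda>x. \<Sum>j\<in>J. c j * v j x) x = (\<Sum>k\<in>J. c k * grad b (v k) x)" (is ?g)
proof -
  have *: "((\<lambda>x. \<Sum>j\<in>J. c j * v j x) has_derivative
     (\<lambda>y. \<Sum>i\<in>J. c i * (\<Sum>a\<in>UNIV. grad a (v i) x * y $ a))) (at x)"
    by (intro has_derivative_sum has_derivative_mult_right has_derivative_grad[OF assms(2)])
  then show ?d by (auto simp: differentiable_def)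
  show ?g by (subst grad_eqI[OF *]) (simp add: axis_def if_distrib cong: if_cong)
qed

text \<open>Expanding the divergence of the cofactor row, the second-order terms cancel in pairs:
  for fixed \<open>k \<noteq> i\<close>, composing with the transposition of \<open>i\<close> and \<open>k\<close> flips
  the sign of a permutation but preserves the term, since second derivatives are symmetric.\<close>

lemma det_grad_eq_divergence:
  fixes u :: "'n::finite \<Rightarrow> real^'n \<Rightarrow> real" and i :: 'n
    and t :: "('n \<Rightarrow> 'n) \<Rightarrow> real^'n \<Rightarrow> real" and w :: "'n \<Rightarrow> real^'n \<Rightarrow> real"
  assumes u: "\<And>j. C2 (u j)"
    and t_def: "t = (\<lambda>\<sigma> x. u i x * (\<Prod>j\<in>UNIV-{i}. grad (\<sigma> j) (u j) x))"
    and w_def: "w = (\<lambda>a x. \<Sum>\<sigma>\<in>{\<sigma>. \<sigma> permutes (UNIV::'n set) \<and> \<sigma> i = a}. real_of_int (sign \<sigma>) * t \<sigma> x)"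
  shows "w a differentiable (at x)" "continuous_on UNIV (grad a (w a))"
    "(\<Sum>a\<in>UNIV. grad a (w a) x) = det (\<chi> j a. grad a (u j) x)"
proof -
  let ?PP = "{\<sigma>. \<sigma> permutes (UNIV::'n set)}"
  have finP: "finite ?PP" by (rule finite_permutations) simp
  have tdiff: "t \<sigma> differentiable (at x)" for \<sigma> x
    unfolding t_def by (intro differentiable_mult grad_prod(1)) (auto simp: C2D[OF u])
  have tgrad: "grad b (t \<sigma>) x = grad b (u i) x * (\<Prod>j\<in>UNIV-{i}. grad (\<sigma> j) (u j) x)
     + u i x * (\<Sum>k\<in>UNIV-{i}. grad b (grad (\<sigma> k) (u k)) x * (\<Prod>j\<in>UNIV-{i}-{k}. grad (\<sigma> j) (u j) x))" for b \<sigma> x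
    unfolding t_def by (subst grad_mult, simp add: C2D[OF u], rule grad_prod(1)) (auto simp: C2D[OF u] grad_prod(2))
  have wgrad: "w a differentiable (at x)"
    "grad b (w a) x = (\<Sum>\<sigma>\<in>{\<sigma>. \<sigma> permutes (UNIV::'n set) \<and> \<sigma> i = a}. real_of_int (sign \<sigma>) * grad b (t \<sigma>) x)" for a b x
    unfolding w_def by (rule grad_sum_cmult; use finP tdiff in \<open>auto intro: finite_subset[OF _ finP]\<close>)+
  show "w a differentiable (at x)" by (rule wgrad(1))
  show "continuous_on UNIV (grad a (w a))"
    unfolding wgrad(2)[abs_def] tgrad by (intro continuous_intros C2D[OF u])
  \<comment> \<open>\<open>?s \<sigma> k\<close> arises when the outer derivative hits the factor of
    row \<open>k\<close>; these are the terms to be cancelled.\<close>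
  let ?s = "\<lambda>\<sigma> k. grad (\<sigma> i) (grad (\<sigma> k) (u k)) x * (\<Prod>j\<in>UNIV-{i}-{k}. grad (\<sigma> j) (u j) x)"
  have cancel: "(\<Sum>\<sigma>\<in>?PP. real_of_int (sign \<sigma>) * ?s \<sigma> k) = 0" if "k \<noteq> i" for k
  proof -
    let ?\<tau> = "Transposition.transpose i k"
    have \<tau>: "?\<tau> permutes UNIV" by (simp add: permutes_swap_id)
    have "(\<Sum>\<sigma>\<in>?PP. real_of_int (sign \<sigma>) * ?s \<sigma> k) = (\<Sum>\<sigma>\<in>?PP. real_of_int (sign (\<sigma> \<circ> ?\<tau>)) * ?s (\<sigma> \<circ> ?\<tau>) k)"
      by (rule sum_permutations_compose_right[OF \<tau>])
    also have "\<dots> = (\<Sum>\<sigma>\<in>?PP. - (real_of_int (sign \<sigma>) * ?s \<sigma> k))"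
    proof (rule sum.cong[OF refl])
      fix \<sigma> assume "\<sigma> \<in> ?PP"
      then have "sign (\<sigma> \<circ> ?\<tau>) = - sign \<sigma>"
        using that by (subst sign_compose) (auto simp: sign_swap_id permutation_permutes intro: \<tau>)
      moreover have "?s (\<sigma> \<circ> ?\<tau>) k = ?s \<sigma> k"
        using C2D(3)[OF u] by (auto intro!: arg_cong2[where f="(*)"] prod.cong simp: transpose_apply_other)
      ultimately show "real_of_int (sign (\<sigma> \<circ> ?\<tau>)) * ?s (\<sigma> \<circ> ?\<tau>) k = - (real_of_int (sign \<sigma>) * ?s \<sigma> k)"
        by simp
    qed
    finally show ?thesis by (simp add: sum_negf)
  qed
  have "(\<Sum>a\<in>UNIV. grad a (w a) x)
     = (\<Sum>a\<in>UNIV. \<Sum>\<sigma>\<in>{\<sigma>. \<sigma> permutes (UNIV::'n set) \<and> \<sigma> i = a}. real_of_int (sign \<sigma>) * grad (\<sigma> i) (t \<sigma>) x)"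
    by (simp add: wgrad(2))
  also have "\<dots> = (\<Sum>\<sigma>\<in>?PP. real_of_int (sign \<sigma>) * grad (\<sigma> i) (t \<sigma>) x)"
    using sum.group[OF finP finite subset_UNIV, of "\<lambda>\<sigma>. real_of_int (sign \<sigma>) * grad (\<sigma> i) (t \<sigma>) x" "\<lambda>\<sigma>. \<sigma> i"]
    by (simp only: mem_Collect_eq)
  also have "\<dots> = (\<Sum>\<sigma>\<in>?PP. real_of_int (sign \<sigma>) * (\<Prod>j\<in>UNIV. grad (\<sigma> j) (u j) x)
      + u i x * (\<Sum>k\<in>UNIV-{i}. real_of_int (sign \<sigma>) * ?s \<sigma> k))"
    by (rule sum.cong[OF refl])
      (simp add: tgrad prod.remove[of UNIV i] algebra_simps sum_distrib_left)
  also have "\<dots> = det (\<chi> j a. grad a (u j) x) + u i x * (\<Sum>\<sigma>\<in>?PP. \<Sum>k\<in>UNIV-{i}. real_of_int (sign \<sigma>) * ?s \<sigma> k)"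
    by (simp add: sum.distrib det_def sum_distrib_left)
  also have "(\<Sum>\<sigma>\<in>?PP. \<Sum>k\<in>UNIV-{i}. real_of_int (sign \<sigma>) * ?s \<sigma> k) = 0"
    by (subst sum.swap) (simp add: cancel)
  finally show "(\<Sum>a\<in>UNIV. grad a (w a) x) = det (\<chi> j a. grad a (u j) x)" by simp
qed

lemma set_integrable_continuous_bounded:
  fixes f :: "real^'n \<Rightarrow> real"
  assumes "continuous_on UNIV f" "bounded V" "open V"
  shows "set_integrable lborel V f"
proof -
  have "set_integrable lborel (closure V) f"
    unfolding set_integrable_def
    by (rule borel_integrable_compact) (use assms continuous_on_subset compact_closure in auto)
  then show ?thesis
    by (rule set_integrable_subset) (use assms closure_subset in auto)
qed

text \<open>By \<open>det_grad_eq_divergence\<close> the integrand is the divergence of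
  \<open>w\<close>, that is, of \<open>u i\<close> times the cofactors of row \<open>i\<close>. Each
  term of \<open>w\<close> contains \<open>u i\<close> and one entry of every other row, so
  \<open>z\<close> forces \<open>w\<close> to vanish on \<open>V - K\<close>.\<close>

lemma integral_det_grad_eq_0:
  fixes u :: "'n::finite \<Rightarrow> real^'n \<Rightarrow> real"
  assumes u: "\<And>j. C2 (u j)" and V: "open V" "bounded V" and K: "compact K" "K \<subseteq> V"
    and z: "\<And>x. x \<in> V - K \<Longrightarrow> u i x = 0 \<or> (\<exists>j. j \<noteq> i \<and> (\<forall>a. grad a (u j) x = 0))"
  shows "(LINT x:V|lborel. det (\<chi> j a. grad a (u j) x)) = 0"
proof -
  define t where "t = (\<lambda>\<sigma> x. u i x * (\<Prod>j\<in>UNIV-{i}. grad (\<sigma> j) (u j) x))"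
  define w where "w = (\<lambda>a x. \<Sum>\<sigma>\<in>{\<sigma>. \<sigma> permutes (UNIV::'n set) \<and> \<sigma> i = a}. real_of_int (sign \<sigma>) * t \<sigma> x)"
  note w = det_grad_eq_divergence[OF u t_def w_def]
  have "t \<sigma> x = 0" if "x \<in> V - K" for \<sigma> x
    using z[OF that] by (auto simp: t_def)
  then have w0: "w a x = 0" if "x \<in> V - K" for a x
    using that by (simp add: w_def)
  have "(LINT x:V|lborel. det (\<chi> j a. grad a (u j) x)) = (LINT x:V|lborel. (\<Sum>a\<in>UNIV. grad a (w a) x))"
    by (simp add: w(3))
  also have "\<dots> = (\<Sum>a\<in>UNIV. LINT x:V|lborel. grad a (w a) x)"
    unfolding set_lebesgue_integral_def scaleR_sum_right
    by (rule Bochner_Integration.integral_sum)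
      (use set_integrable_continuous_bounded[OF w(2) V(2,1)] in \<open>simp add: set_integrable_def\<close>)
  also have "\<dots> = 0"
    using set_integral_grad_compact_support[OF V(1) K w(1) w0 w(2)] by simp
  finally show ?thesis .
qed

subsection \<open>The degree integral\<close>

definition C2_field :: "(real^'n \<Rightarrow> real^'n) \<Rightarrow> bool" where
  "C2_field P \<longleftrightarrow> (\<forall>j. C2 (\<lambda>x. P x $ j))"

text \<open>Density of the pullback under \<open>P\<close> of the volume form weighted by the
  product of \<open>bump\<close> over the coordinates. For \<open>P\<close> large on the frontier,
  its integral is the classical integral formula for the degree, up to the factor
  \<open>degree_unit\<close>.\<close>

definition degree_kernel :: "(real^'n \<Rightarrow> real^'n) \<Rightarrow> real^'n \<Rightarrow> real" where
  "degree_kernel P x = (\<Prod>j\<in>UNIV. bump (P x $ j)) * det (\<chi> j a. grad a (\<lambda>x. P x $ j) x)"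

definition degree_integral :: "(real^'n \<Rightarrow> real^'n) \<Rightarrow> (real^'n) set \<Rightarrow> real" where
  "degree_integral P V = (LINT x:V|lborel. degree_kernel P x)"

lemma continuous_on_degree_kernel:
  assumes "C2_field P"
  shows "continuous_on UNIV (degree_kernel P)"
proof -
  have 1: "continuous_on UNIV (\<lambda>x. bump (P x $ j))" for j
    using assms C2D(4) continuous_on_compose2[OF continuous_on_bump[of UNIV]] by (fastforce simp: C2_field_def)
  show ?thesis
    unfolding degree_kernel_def[abs_def] det_def
    using assms by (auto intro!: continuous_intros 1 C2D(5) simp: C2_field_def)
qed

lemma degree_kernel_0: "1 \<le> \<bar>P x $ j\<bar> \<Longrightarrow> degree_kernel P x = 0"
  using bump_eq_0[of "P x $ j"] by (auto simp: degree_kernel_def)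

lemma set_integrable_degree_kernel:
  "C2_field P \<Longrightarrow> bounded V \<Longrightarrow> open V \<Longrightarrow> set_integrable lborel V (degree_kernel P)"
  by (intro set_integrable_continuous_bounded continuous_on_degree_kernel)

text \<open>The kernel is the Jacobian determinant of \<open>x \<mapsto> (F (P x $ j))\<^sub>j\<close> for an antiderivative
  \<open>F\<close> of the bump function; it is affine in each row, which leaves a null Lagrangian for the difference.\<close>

lemma degree_integral_change_component:
  fixes P P' :: "real^'n \<Rightarrow> real^'n"
  assumes P: "C2_field P" "C2_field P'" and eq: "\<And>j x. j \<noteq> i \<Longrightarrow> P' x $ j = P x $ j"
    and V: "open V" "bounded V" and K: "compact K" "K \<subseteq> V"
    and far: "\<And>x. x \<in> V - K \<Longrightarrow> \<exists>j. P x $ j > 1 \<and> P' x $ j > 1 \<or> P x $ j < -1 \<and> P' x $ j < -1"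
  shows "degree_integral P V = degree_integral P' V"
proof -
  obtain F where F: "\<And>s. (F has_real_derivative bump s) (at s)"
    "\<And>s t. s > 1 \<Longrightarrow> t > 1 \<Longrightarrow> F s = F t" "\<And>s t. s < -1 \<Longrightarrow> t < -1 \<Longrightarrow> F s = F t"
    using bump_antiderivative by blast
  have C2F: "C2 (\<lambda>x. F (Q x $ j))" if "C2_field Q" for Q :: "real^'n \<Rightarrow> real^'n" and j
    by (rule C2_compose[OF _ F(1) bump_has_derivative])
      (use that in \<open>auto simp: C2_field_def intro!: continuous_intros\<close>)
  have gF: "grad a (\<lambda>x. F (Q x $ j)) x = bump (Q x $ j) * grad a (\<lambda>x. Q x $ j) x"
    if "C2_field Q" for Q :: "real^'n \<Rightarrow> real^'n" and j a x
    using grad_compose[OF C2D(1) F(1)] that by (auto simp: C2_field_def)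
  have kernel: "degree_kernel Q x = det (\<chi> j. \<chi> a. grad a (\<lambda>x. F (Q x $ j)) x)"
    if "C2_field Q" for Q :: "real^'n \<Rightarrow> real^'n" and x
  proof -
    have "degree_kernel Q x = det (\<chi> j. bump (Q x $ j) *s (\<chi> a. grad a (\<lambda>x. Q x $ j) x))"
      unfolding degree_kernel_def by (rule det_rows_mul[symmetric])
    also have "\<dots> = det (\<chi> j. \<chi> a. grad a (\<lambda>x. F (Q x $ j)) x)"
      by (simp add: gF[OF that] vector_scalar_mult_def)
    finally show ?thesis .
  qed
  define u where "u j = (if j = i then \<lambda>x. F (P' x $ i) - F (P x $ i) else (\<lambda>x. F (P x $ j)))" for j
  have u: "C2 (u j)" for j
    unfolding u_def using C2_diff[OF C2F[OF P(2)] C2F[OF P(1)]] C2F[OF P(1)] by auto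
  have gi: "grad a (u i) x = grad a (\<lambda>x. F (P' x $ i)) x - grad a (\<lambda>x. F (P x $ i)) x" for a x
    using grad_diff[OF C2D(1)[OF C2F[OF P(2)]] C2D(1)[OF C2F[OF P(1)]]] by (simp add: u_def)
  let ?A = "\<lambda>x. \<chi> a. grad a (u i) x" and ?B = "\<lambda>x. \<chi> a. grad a (\<lambda>x. F (P x $ i)) x"
    and ?C = "\<lambda>x j. \<chi> a. grad a (\<lambda>x. F (P x $ j)) x"
  have "degree_kernel P' x = det (\<chi> j. \<chi> a. grad a (u j) x) + degree_kernel P x" for x
  proof -
    have "(\<lambda>x. F (P' x $ j)) = (\<lambda>x. F (P x $ j))" if "j \<noteq> i" for j
      using eq[OF that] by auto
    then have "degree_kernel P' x = det (\<chi> j. if j = i then ?A x + ?B x else ?C x j)"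
      unfolding kernel[OF P(2)]
      by (auto intro!: arg_cong[where f=det] simp: vec_eq_iff gi)
    also have "\<dots> = det (\<chi> j. if j = i then ?A x else ?C x j) + det (\<chi> j. if j = i then ?B x else ?C x j)"
      by (rule det_row_add)
    also have "(\<chi> j. if j = i then ?A x else ?C x j) = (\<chi> j. \<chi> a. grad a (u j) x)"
      by (auto simp: vec_eq_iff u_def)
    also have "det (\<chi> j. if j = i then ?B x else ?C x j) = degree_kernel P x"
      unfolding kernel[OF P(1)] by (auto intro!: arg_cong[where f=det] simp: vec_eq_iff)
    finally show ?thesis .
  qed
  then have "det (\<chi> j a. grad a (u j) x) = degree_kernel P' x - degree_kernel P x" for x
    by simp
  moreover have "(LINT x:V|lborel. det (\<chi> j a. grad a (u j) x)) = 0"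
  proof (rule integral_det_grad_eq_0[OF u V K])
    fix x assume "x \<in> V - K"
    from far[OF this] obtain j where j: "P x $ j > 1 \<and> P' x $ j > 1 \<or> P x $ j < -1 \<and> P' x $ j < -1" by blast
    \<comment> \<open>For \<open>j = i\<close> the antiderivative \<open>F\<close> takes the same
      value at both arguments; for \<open>j \<noteq> i\<close> row \<open>j\<close> vanishes because
      \<open>bump\<close> does beyond 1.\<close>
    show "u i x = 0 \<or> (\<exists>j. j \<noteq> i \<and> (\<forall>a. grad a (u j) x = 0))"
    proof (cases "j = i")
      case True
      then show ?thesis using j F(2,3) by (auto simp: u_def)
    next
      case False
      then have "grad a (u j) x = 0" for a
        using j bump_eq_0[of "P x $ j"] by (auto simp: u_def gF[OF P(1)])
      then show ?thesis using False by blast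
    qed
  qed
  ultimately have "(LINT x:V|lborel. degree_kernel P' x - degree_kernel P x) = 0" by simp
  then show ?thesis
    unfolding degree_integral_def
    using set_integral_diff(2)[OF set_integrable_degree_kernel[OF P(2) V(2,1)] set_integrable_degree_kernel[OF P(1) V(2,1)]]
    by simp
qed

text \<open>The components of \<open>P\<close> are exchanged for those of \<open>P'\<close> one
  after the other. A witness \<open>j\<close> from \<open>far\<close> serves for every intermediate
  field \<open>Q S\<close>, since its \<open>j\<close>-th component is that of \<open>P\<close> or
  of \<open>P'\<close>, and both lie on the same side.\<close>

lemma degree_integral_same_sign:
  fixes P P' :: "real^'n \<Rightarrow> real^'n"
  assumes P: "C2_field P" "C2_field P'" and V: "open V" "bounded V" and K: "compact K" "K \<subseteq> V"
    and far: "\<And>x. x \<in> V - K \<Longrightarrow> \<exists>j. P x $ j > 1 \<and> P' x $ j > 1 \<or> P x $ j < -1 \<and> P' x $ j < -1"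
  shows "degree_integral P V = degree_integral P' V"
proof -
  define Q where "Q S x = (\<chi> j. if j \<in> S then P' x $ j else P x $ j)" for S x
  have Q: "C2_field (Q S)" for S
    unfolding C2_field_def
  proof
    fix j show "C2 (\<lambda>x. Q S x $ j)"
      using P by (cases "j \<in> S") (auto simp: C2_field_def Q_def)
  qed
  have "degree_integral P V = degree_integral (Q S) V" if "finite S" for S
    using that
  proof induction
    case empty
    then show ?case by (simp add: Q_def[abs_def])
  next
    case (insert i S)
    have "degree_integral (Q S) V = degree_integral (Q (insert i S)) V"
    proof (rule degree_integral_change_component[OF Q Q _ V K])
      show "Q (insert i S) x $ j = Q S x $ j" if "j \<noteq> i" for j x
        using that by (simp add: Q_def)
      show "\<exists>j. Q S x $ j > 1 \<and> Q (insert i S) x $ j > 1 \<or> Q S x $ j < -1 \<and> Q (insert i S) x $ j < -1"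
        if "x \<in> V - K" for x
        using far[OF that] by (auto simp: Q_def)
    qed
    with insert.IH show ?case by simp
  qed
  from this[of UNIV] show ?thesis by (simp add: Q_def[abs_def])
qed

section \<open>Homotopy invariance of the degree integral\<close>

lemma C2_fieldD: "C2_field P \<Longrightarrow> C2 (\<lambda>x. P x $ j)"
  by (simp add: C2_field_def)

lemma C2_field_continuous: "C2_field P \<Longrightarrow> continuous_on S P"
  using continuous_on_vec_lambda[of UNIV "\<lambda>j x. P x $ j"] C2D(4)[OF C2_fieldD]
  by (auto simp: vec_lambda_eta intro: continuous_on_subset[of UNIV])

text \<open>The threshold 2 leaves room for a change by 1: a component beyond 2 stays beyond 1 and
  keeps its sign. The set \<open>K\<close> where all components of \<open>P\<close> are at most 2 in
  modulus avoids the frontier by \<open>fr\<close>.\<close>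

lemma degree_integral_close:
  fixes P P' :: "real^'n \<Rightarrow> real^'n"
  assumes P: "C2_field P" "C2_field P'" and V: "open V" "bounded V"
    and fr: "\<And>x. x \<in> frontier V \<Longrightarrow> \<exists>j. \<bar>P x $ j\<bar> > 2"
    and close: "\<And>x j. x \<in> V \<Longrightarrow> \<bar>P' x $ j - P x $ j\<bar> \<le> 1"
  shows "degree_integral P V = degree_integral P' V"
proof -
  define K where "K = closure V \<inter> (\<Inter>j. {x. \<bar>P x $ j\<bar> \<le> 2})"
  have "closed {x. \<bar>P x $ j\<bar> \<le> 2}" for j
    by (intro closed_Collect_le continuous_intros C2_field_continuous P)
  then have Kc: "compact K"
    unfolding K_def using V compact_closure by (auto intro!: compact_Int_closed)
  have KV: "K \<subseteq> V"
  proof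
    fix x assume x: "x \<in> K"
    then have "\<not> (\<exists>j. \<bar>P x $ j\<bar> > 2)" by (auto simp: K_def not_less)
    then have "x \<notin> frontier V" using fr by blast
    with x V show "x \<in> V" by (auto simp: K_def frontier_def interior_open)
  qed
  show ?thesis
  proof (rule degree_integral_same_sign[OF P V Kc KV])
    fix x assume x: "x \<in> V - K"
    then obtain j where "\<bar>P x $ j\<bar> > 2"
      using closure_subset[of V] by (auto simp: K_def not_le)
    with close[of x j] x show "\<exists>j. P x $ j > 1 \<and> P' x $ j > 1 \<or> P x $ j < -1 \<and> P' x $ j < -1"
      by (intro exI[of _ j]) auto
  qed
qed

lemma C2_field_add: "C2_field P \<Longrightarrow> C2_field Q \<Longrightarrow> C2_field (\<lambda>x. P x + Q x)"
  and C2_field_diff: "C2_field P \<Longrightarrow> C2_field Q \<Longrightarrow> C2_field (\<lambda>x. P x - Q x)"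
  and C2_field_scaleR: "C2_field P \<Longrightarrow> C2_field (\<lambda>x. c *\<^sub>R P x)"
  and C2_field_const: "C2_field (\<lambda>x. v)"
  by (auto simp: C2_field_def intro: C2_add C2_diff C2_cmult C2_const)

lemma C2_field_linear: "bounded_linear f \<Longrightarrow> C2_field f"
  unfolding C2_field_def using C2_linear bounded_linear_compose[OF bounded_linear_vec_nth] by blast

lemma C2_field_polynomial: "polynomial_function p \<Longrightarrow> C2_field p"
  unfolding C2_field_def using C2_polynomial_component by blast

text \<open>The segment is cut into \<open>N\<close> steps so short that no component moves by more
  than 1 anywhere on \<open>V\<close>; each step is an instance of
  \<open>degree_integral_close\<close>.\<close>

lemma degree_integral_linear_homotopy:
  fixes P P' :: "real^'n \<Rightarrow> real^'n"
  assumes P: "C2_field P" "C2_field P'" and V: "open V" "bounded V"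
    and fr: "\<And>x t. x \<in> frontier V \<Longrightarrow> t \<in> {0..1} \<Longrightarrow> \<exists>j. \<bar>((1 - t) *\<^sub>R P x + t *\<^sub>R P' x) $ j\<bar> > 2"
  shows "degree_integral P V = degree_integral P' V"
proof -
  have "compact (closure V)" using V by simp
  moreover have "continuous_on (closure V) (\<lambda>x. P' x - P x)"
    by (intro continuous_intros C2_field_continuous P)
  ultimately have "bounded ((\<lambda>x. P' x - P x) ` closure V)"
    using compact_continuous_image compact_imp_bounded by blast
  then obtain B where B: "\<And>x. x \<in> closure V \<Longrightarrow> norm (P' x - P x) \<le> B"
    by (auto simp: bounded_iff)
  obtain N :: nat where "max B 1 \<le> N"
    using real_arch_simple by blast
  then have N: "N > 0" "B \<le> N" by auto
  define H where "H k x = (1 - real k / N) *\<^sub>R P x + (real k / N) *\<^sub>R P' x" for k x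
  have CH: "C2_field (H k)" for k
    unfolding H_def by (intro C2_field_add C2_field_scaleR P)
  have "degree_integral P V = degree_integral (H k) V" if "k \<le> N" for k
    using that
  proof (induction k)
    case 0
    then show ?case by (simp add: H_def[abs_def])
  next
    case (Suc k)
    have "degree_integral (H k) V = degree_integral (H (Suc k)) V"
    proof (rule degree_integral_close[OF CH CH V])
      show "\<exists>j. \<bar>H k x $ j\<bar> > 2" if "x \<in> frontier V" for x
        unfolding H_def by (rule fr[OF that]) (use Suc.prems N in auto)
      fix x j assume x: "x \<in> V"
      have "H (Suc k) x - H k x = (1 / N) *\<^sub>R (P' x - P x)"
        using N by (simp add: H_def algebra_simps add_divide_distrib)
      moreover have "\<bar>((1 / N) *\<^sub>R (P' x - P x)) $ j\<bar> \<le> norm ((1 / N) *\<^sub>R (P' x - P x))"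
        by (rule component_le_norm_cart)
      moreover have "norm (P' x - P x) \<le> N"
        using B[of x] x closure_subset[of V] N by force
      ultimately show "\<bar>H (Suc k) x $ j - H k x $ j\<bar> \<le> 1"
        using N by (simp add: divide_simps flip: vector_minus_component)
    qed
    with Suc show ?case by simp
  qed
  from this[of N] N show ?thesis by (simp add: H_def[abs_def])
qed

text \<open>The norm is at most the sum of the moduli of the components; hence the factor
  \<open>CARD('n)\<close> in the later smallness conditions on \<open>e\<close>.\<close>

lemma exists_large_component:
  fixes v :: "real^'n"
  assumes "norm v > real CARD('n) * c"
  shows "\<exists>j. \<bar>v $ j\<bar> > c"
proof (rule ccontr)
  assume "\<not> ?thesis"
  then have "(\<Sum>j\<in>UNIV. \<bar>v $ j\<bar>) \<le> (\<Sum>j\<in>(UNIV::'n set). c)"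
    by (intro sum_mono) (auto simp: not_less)
  with norm_le_l1_cart[of v] assms show False by simp
qed

text \<open>The condition on \<open>e\<close> turns the lower bound \<open>m\<close> for the norm
  into a component beyond \<open>2 * e\<close>, which is beyond 2 after division by
  \<open>e\<close>.\<close>

lemma degree_integral_homotopy_scaled:
  fixes P P' :: "real^'n \<Rightarrow> real^'n"
  assumes P: "C2_field P" "C2_field P'" and V: "open V" "bounded V"
    and fr: "\<And>x t. x \<in> frontier V \<Longrightarrow> t \<in> {0..1} \<Longrightarrow> norm ((1 - t) *\<^sub>R P x + t *\<^sub>R P' x) \<ge> m"
    and e: "0 < e" "2 * real CARD('n) * e < m"
  shows "degree_integral (\<lambda>x. (1/e) *\<^sub>R P x) V = degree_integral (\<lambda>x. (1/e) *\<^sub>R P' x) V"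
proof (rule degree_integral_linear_homotopy[OF C2_field_scaleR C2_field_scaleR V, OF P])
  fix x and t :: real assume "x \<in> frontier V" "t \<in> {0..1}"
  then have "norm ((1 - t) *\<^sub>R P x + t *\<^sub>R P' x) > real CARD('n) * (2 * e)"
    using fr[of x t] e by simp
  then obtain j where "\<bar>((1 - t) *\<^sub>R P x + t *\<^sub>R P' x) $ j\<bar> > 2 * e"
    using exists_large_component by blast
  moreover have "((1 - t) *\<^sub>R (1/e) *\<^sub>R P x + t *\<^sub>R (1/e) *\<^sub>R P' x) $ j = ((1 - t) *\<^sub>R P x + t *\<^sub>R P' x) $ j / e"
    by (simp add: add_divide_distrib)
  ultimately show "\<exists>j. \<bar>((1 - t) *\<^sub>R (1/e) *\<^sub>R P x + t *\<^sub>R (1/e) *\<^sub>R P' x) $ j\<bar> > 2"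
    using e by (intro exI[of _ j]) (simp add: field_simps)
qed

lemma degree_integral_rescale:
  fixes P :: "real^'n \<Rightarrow> real^'n"
  assumes P: "C2_field P" and V: "open V" "bounded V"
    and fr: "\<And>x. x \<in> frontier V \<Longrightarrow> norm (P x) \<ge> m"
    and e: "0 < e" "2 * real CARD('n) * e < m" and e': "0 < e'" "2 * real CARD('n) * e' < m"
  shows "degree_integral (\<lambda>x. (1/e) *\<^sub>R P x) V = degree_integral (\<lambda>x. (1/e') *\<^sub>R P x) V"
proof (rule degree_integral_linear_homotopy[OF C2_field_scaleR C2_field_scaleR V, OF P P])
  fix x and t :: real assume x: "x \<in> frontier V" and t: "t \<in> {0..1}"
  \<comment> \<open>The segment between the two scaled fields consists of multiples of
    \<open>P\<close> by factors of at least \<open>1/d\<close>, so the larger scale is the worst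
    case.\<close>
  define d where "d = max e e'"
  have d: "d > 0" "2 * real CARD('n) * d < m" using e e' by (auto simp: d_def max_def)
  have "1/d \<le> 1/e" "1/d \<le> 1/e'" using e e' by (auto simp: d_def frac_le)
  then have "(1-t) * (1/d) + t * (1/d) \<le> (1-t) * (1/e) + t * (1/e')"
    using t by (intro add_mono mult_left_mono) auto
  moreover have "(1-t) * (1/d) + t * (1/d) = 1/d" by (subst distrib_right[symmetric]) simp
  ultimately have "1/d \<le> (1-t) * (1/e) + t * (1/e')" by simp
  moreover have "norm (P x) > real CARD('n) * (2 * d)" using fr[OF x] d by simp
  then obtain j where j: "\<bar>P x $ j\<bar> > 2 * d"
    using exists_large_component by blast
  moreover have "\<bar>((1 - t) *\<^sub>R (1/e) *\<^sub>R P x + t *\<^sub>R (1/e') *\<^sub>R P x) $ j\<bar>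
      = ((1-t) * (1/e) + t * (1/e')) * \<bar>P x $ j\<bar>"
  proof -
    have "((1 - t) *\<^sub>R (1/e) *\<^sub>R P x + t *\<^sub>R (1/e') *\<^sub>R P x) $ j = ((1-t) * (1/e) + t * (1/e')) * P x $ j"
      by (simp add: algebra_simps)
    moreover have "0 \<le> (1-t) * (1/e) + t * (1/e')" using t e e' by simp
    ultimately show ?thesis by (simp only: abs_mult abs_of_nonneg)
  qed
  ultimately have "\<bar>((1 - t) *\<^sub>R (1/e) *\<^sub>R P x + t *\<^sub>R (1/e') *\<^sub>R P x) $ j\<bar> \<ge> (1/d) * \<bar>P x $ j\<bar>"
    by (metis abs_ge_zero mult_right_mono)
  moreover have "(1/d) * \<bar>P x $ j\<bar> > 2" using j d by (simp add: field_simps)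
  ultimately show "\<exists>j. \<bar>((1 - t) *\<^sub>R (1/e) *\<^sub>R P x + t *\<^sub>R (1/e') *\<^sub>R P x) $ j\<bar> > 2"
    by (intro exI[of _ j]) linarith
qed

subsection \<open>Linear maps\<close>

text \<open>Total mass of the kernel of the identity. With n for \<open>CARD('n)\<close>, the scale
  \<open>1 / (2 n + 1)\<close> satisfies \<open>2 n e < 1\<close>, under which the value is
  independent of \<open>e\<close>; the nested quotient fits the form \<open>1/e\<close> of
  \<open>degree_integral_rescale\<close>.\<close>

definition degree_unit :: "'n::finite itself \<Rightarrow> real" where
  "degree_unit _ = degree_integral (\<lambda>x::real^'n. (1 / (1 / real (2 * CARD('n) + 1))) *\<^sub>R x) (ball 0 1)"

lemma prod_Basis_cart:
  fixes f :: "real^'n \<Rightarrow> real"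
  shows "(\<Prod>b\<in>Basis. f b) = (\<Prod>i\<in>UNIV. f (axis i 1))"
proof -
  have B: "(Basis :: (real^'n) set) = (\<lambda>i. axis i 1) ` UNIV"
    by (auto simp: Basis_vec_def)
  have inj: "inj (\<lambda>i. axis i 1 :: real^'n)"
    by (auto simp: inj_on_def axis_eq_axis)
  show ?thesis unfolding B prod.reindex[OF inj] o_def ..
qed

text \<open>The preimage of a box is a box with the sides permuted, hence of the same volume.
  Transpositions are what is needed: they produce the sign of orientation-reversing maps.\<close>

lemma lborel_distr_permute:
  assumes p: "p permutes (UNIV :: 'n::finite set)"
  shows "distr lborel borel (\<lambda>x::real^'n. \<chi> j. x $ p j) = lborel"
proof (rule lborel_eqI[symmetric])
  show "sets (distr lborel borel (\<lambda>x::real^'n. \<chi> j. x $ p j)) = sets borel" by simp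
  fix l u :: "real^'n"
  assume le: "\<And>b. b \<in> Basis \<Longrightarrow> l \<bullet> b \<le> u \<bullet> b"
  let ?q = "inv p"
  let ?L = "\<chi> j. l $ ?q j" and ?U = "\<chi> j. u $ ?q j"
  have le': "l $ i \<le> u $ i" for i
    using le[of "axis i 1"] by (simp add: inner_axis)
  have pq: "p (?q i) = i" "?q (p i) = i" for i
    using p by (auto simp: permutes_inverses)
  have "continuous_on UNIV (\<lambda>x::real^'n. \<chi> j. x $ p j)"
    by (intro continuous_intros)
  then have [measurable]: "(\<lambda>x::real^'n. \<chi> j. x $ p j) \<in> borel_measurable lborel"
    using borel_measurable_continuous_onI by auto
  have "(\<lambda>x::real^'n. \<chi> j. x $ p j) -` box l u = box ?L ?U"
  proof (intro set_eqI iffI)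
    fix x assume "x \<in> (\<lambda>x::real^'n. \<chi> j. x $ p j) -` box l u"
    then have *: "l $ i < x $ p i \<and> x $ p i < u $ i" for i by (auto simp: mem_box_cart)
    show "x \<in> box ?L ?U" using *[of "?q i" for i] by (simp add: mem_box_cart pq)
  next
    fix x assume "x \<in> box ?L ?U"
    then have *: "l $ ?q i < x $ i \<and> x $ i < u $ ?q i" for i by (auto simp: mem_box_cart)
    show "x \<in> (\<lambda>x::real^'n. \<chi> j. x $ p j) -` box l u"
      using *[of "p i" for i] by (simp add: mem_box_cart pq)
  qed
  then have "emeasure (distr lborel borel (\<lambda>x::real^'n. \<chi> j. x $ p j)) (box l u) = emeasure lborel (box ?L ?U)"
    by (subst emeasure_distr) auto
  also have "\<dots> = (\<Prod>b\<in>Basis. (?U - ?L) \<bullet> b)"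
    by (rule emeasure_lborel_box) (auto simp: Basis_vec_def inner_axis le')
  also have "(\<Prod>b\<in>Basis. (?U - ?L) \<bullet> b) = (\<Prod>i\<in>UNIV. u $ ?q i - l $ ?q i)"
    by (subst prod_Basis_cart) (simp add: inner_axis)
  also have "\<dots> = (\<Prod>i\<in>UNIV. u $ i - l $ i)"
    using prod.permute[OF permutes_inv[OF p], of "\<lambda>i. u $ i - l $ i"] by (simp add: o_def)
  also have "\<dots> = (\<Prod>b\<in>Basis. (u - l) \<bullet> b)"
    by (subst prod_Basis_cart) (simp add: inner_axis)
  finally show "emeasure (distr lborel borel (\<lambda>x::real^'n. \<chi> j. x $ p j)) (box l u) = (\<Prod>b\<in>Basis. (u - l) \<bullet> b)" .
qed

lemma degree_kernel_affine:
  fixes A :: "real^'n^'n"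
  shows "degree_kernel (\<lambda>x. (1/e) *\<^sub>R (A *v (x - c))) x =
    (\<Prod>j\<in>UNIV. bump ((A *v (x - c)) $ j / e)) * det (\<chi> j a. A $ j $ a / e)"
proof -
  have "grad a (\<lambda>x. ((1/e) *\<^sub>R (A *v (x - c))) $ j) x = A $ j $ a / e" for j a
  proof -
    have "bounded_linear (\<lambda>h. ((1/e) *\<^sub>R (A *v h)) $ j)"
      by (intro bounded_linear_compose[OF bounded_linear_vec_nth] bounded_linear_compose[OF bounded_linear_scaleR_right]
        matrix_vector_mul_bounded_linear)
    then have "((\<lambda>x. ((1/e) *\<^sub>R (A *v (x - c))) $ j) has_derivative (\<lambda>h. ((1/e) *\<^sub>R (A *v h)) $ j)) (at x)"
      by (rule bounded_linear.has_derivative) (auto intro!: derivative_eq_intros)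
    then have "grad a (\<lambda>x. ((1/e) *\<^sub>R (A *v (x - c))) $ j) x = ((1/e) *\<^sub>R (A *v axis a 1)) $ j"
      by (rule grad_eqI)
    then show ?thesis
      by (simp add: matrix_vector_mult_basis column_def)
  qed
  then show ?thesis by (simp add: degree_kernel_def)
qed

lemma degree_kernel_linear:
  fixes A :: "real^'n^'n"
  shows "degree_kernel (\<lambda>x. (1/e) *\<^sub>R (A *v x)) x =
    (\<Prod>j\<in>UNIV. bump ((A *v x) $ j / e)) * det (\<chi> j a. A $ j $ a / e)"
  using degree_kernel_affine[of e A 0] by simp

lemma C2_field_matrix: "C2_field (\<lambda>x. A *v x)"
  by (rule C2_field_linear) (rule matrix_vector_mul_bounded_linear)

text \<open>The threshold \<open>e0\<close> depends on how strongly \<open>A\<close> contracts.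
  Hiding it behind a quantifier gives a property of \<open>A\<close> alone that can be carried
  through an induction over matrices.\<close>

definition linear_degree_sgn :: "real^'n^'n \<Rightarrow> bool" where
  "linear_degree_sgn A \<longleftrightarrow> (\<exists>e0>0. \<forall>e. 0 < e \<and> e < e0 \<longrightarrow>
     degree_integral (\<lambda>x. (1/e) *\<^sub>R (A *v x)) (ball 0 1) = sgn (det A) * degree_unit TYPE('n))"

text \<open>The segment of matrices stays invertible, so on the compact set of parameters and unit
  vectors the norm of the image has a positive minimum \<open>m\<close>, as
  \<open>degree_integral_homotopy_scaled\<close> requires.\<close>

lemma linear_degree_sgn_homotopy:
  fixes A B :: "real^'n^'n"
  assumes A: "linear_degree_sgn A" and sgn: "sgn (det A) = sgn (det B)"
    and nz: "\<And>t. t \<in> {0..1} \<Longrightarrow> det ((1 - t) *\<^sub>R A + t *\<^sub>R B) \<noteq> 0"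
  shows "linear_degree_sgn B"
proof -
  let ?f = "\<lambda>(t, x). norm ((1 - t) *\<^sub>R (A *v x) + t *\<^sub>R (B *v x))"
  have "compact ({0..1::real} \<times> sphere (0::real^'n) 1)" by (intro compact_Times) auto
  moreover have "continuous_on ({0..1::real} \<times> sphere (0::real^'n) 1) ?f"
    by (auto simp: case_prod_beta intro!: continuous_intros linear_continuous_on_compose[where f=snd and g="(*v) M" for M])
  moreover have "{0..1::real} \<times> sphere (0::real^'n) 1 \<noteq> {}" by (auto simp: sphere_eq_empty)
  ultimately obtain t0 x0 where t0: "t0 \<in> {0..1}" "x0 \<in> sphere 0 1"
    "\<And>t x. t \<in> {0..1} \<Longrightarrow> x \<in> sphere 0 1 \<Longrightarrow> ?f (t0, x0) \<le> ?f (t, x)"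
    using continuous_attains_inf[of "{0..1::real} \<times> sphere (0::real^'n) 1" ?f] by fastforce
  define m where "m = ?f (t0, x0)"
  have lin: "((1 - t) *\<^sub>R A + t *\<^sub>R B) *v x = (1 - t) *\<^sub>R (A *v x) + t *\<^sub>R (B *v x)" for t x
    by (simp add: matrix_vector_mult_add_rdistrib scaleR_matrix_vector_assoc)
  have "m > 0"
  proof -
    have "x0 \<noteq> 0" using t0(2) by auto
    moreover have "invertible ((1 - t0) *\<^sub>R A + t0 *\<^sub>R B)" using nz[OF t0(1)] invertible_det_nz by blast
    ultimately have "((1 - t0) *\<^sub>R A + t0 *\<^sub>R B) *v x0 \<noteq> 0"
      using invertible_eq_bij matrix_left_invertible_ker invertible_left_inverse by metis
    then show ?thesis by (simp add: m_def lin)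
  qed
  from A obtain e0 where e0: "e0 > 0" "\<And>e. 0 < e \<Longrightarrow> e < e0 \<Longrightarrow>
     degree_integral (\<lambda>x. (1/e) *\<^sub>R (A *v x)) (ball 0 1) = sgn (det A) * degree_unit TYPE('n)"
    by (auto simp: linear_degree_sgn_def)
  show ?thesis
    unfolding linear_degree_sgn_def
  proof (intro exI[of _ "min e0 (m / (2 * CARD('n)))"] conjI allI impI)
    show "0 < min e0 (m / (2 * CARD('n)))" using e0 \<open>m > 0\<close> by simp
    fix e assume e: "0 < e \<and> e < min e0 (m / (2 * CARD('n)))"
    have "degree_integral (\<lambda>x. (1/e) *\<^sub>R (A *v x)) (ball 0 1) = degree_integral (\<lambda>x. (1/e) *\<^sub>R (B *v x)) (ball 0 1)"
    proof (rule degree_integral_homotopy_scaled[OF C2_field_matrix C2_field_matrix open_ball bounded_ball, where m=m])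
      show "m \<le> norm ((1 - t) *\<^sub>R (A *v x) + t *\<^sub>R (B *v x))" if "x \<in> frontier (ball 0 1)" "t \<in> {0..1}" for x t
        using t0(3)[of t x] that by (simp add: m_def)
      show "0 < e" "2 * real CARD('n) * e < m" using e by (auto simp: field_simps)
    qed
    then show "degree_integral (\<lambda>x. (1/e) *\<^sub>R (B *v x)) (ball 0 1) = sgn (det B) * degree_unit TYPE('n)"
      using e0(2) e sgn by auto
  qed
qed

lemma sgn_prod: "sgn (\<Prod>i\<in>S. f i) = (\<Prod>i\<in>S. sgn (f i :: real))"
  by (induction S rule: infinite_finite_induct) (auto simp: sgn_mult)

text \<open>The segment from the sign matrix \<open>D\<close> to \<open>A\<close> keeps every
  diagonal entry nonzero. For \<open>D\<close> itself, evenness of \<open>bump\<close> reduces the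
  kernel to \<open>det D\<close>, which is 1 or -1, times that of the identity.\<close>

lemma linear_degree_sgn_diagonal:
  fixes A :: "real^'n^'n"
  assumes diag: "\<And>i j. i \<noteq> j \<Longrightarrow> A $ i $ j = 0" and nz: "det A \<noteq> 0"
  shows "linear_degree_sgn A"
proof -
  have A: "A $ i $ i \<noteq> 0" for i
    using nz det_diagonal[OF diag] by (auto simp: prod_zero_iff)
  define D :: "real^'n^'n" where "D = (\<chi> i j. sgn (A $ i $ j))"
  have D0: "D $ i $ j = 0" if "i \<noteq> j" for i j using diag[OF that] by (simp add: D_def)
  have detD: "det D = (\<Prod>i\<in>UNIV. sgn (A $ i $ i))"
    using det_diagonal[OF D0] by (simp add: D_def)
  have Dx: "(D *v x) $ j = sgn (A $ j $ j) * x $ j" for x j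
  proof -
    have "(D *v x) $ j = (\<Sum>k\<in>UNIV. sgn (A $ j $ k) * x $ k)"
      by (simp add: matrix_vector_mult_def D_def)
    also have "\<dots> = (\<Sum>k\<in>UNIV. if k = j then sgn (A $ j $ j) * x $ j else 0)"
      by (rule sum.cong) (auto simp: diag)
    finally show ?thesis by simp
  qed
  have bD: "bump ((D *v x) $ j / e) = bump (x $ j / e)" for x j e
    using A[of j] bump_minus[of "x $ j / e"] by (auto simp: Dx sgn_if)
  have dD: "det (\<chi> j a. D $ j $ a / e) = det D * det (\<chi> j a. (mat 1 :: real^'n^'n) $ j $ a / e)" for e
  proof -
    have "det (\<chi> j a. D $ j $ a / e) = (\<Prod>j\<in>UNIV. D $ j $ j / e)"
      by (subst det_diagonal) (auto simp: D0)
    moreover have "det (\<chi> j a. (mat 1 :: real^'n^'n) $ j $ a / e) = (\<Prod>j\<in>(UNIV::'n set). 1 / e)"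
      by (subst det_diagonal) (auto simp: mat_def)
    ultimately show ?thesis using det_diagonal[OF D0] by (simp add: prod_dividef power_divide)
  qed
  let ?n = "real CARD('n)"
  have sgn1: "sgn (det D) = det D"
    unfolding detD using A by (simp add: sgn_prod)
  have "linear_degree_sgn D"
    unfolding linear_degree_sgn_def
  proof (intro exI[of _ "1 / (2 * ?n)"] conjI allI impI)
    show "0 < 1 / (2 * ?n)" by simp
    fix e assume e: "0 < e \<and> e < 1 / (2 * ?n)"
    have "degree_kernel (\<lambda>x. (1/e) *\<^sub>R (D *v x)) x = det D * degree_kernel (\<lambda>x. (1/e) *\<^sub>R (mat 1 *v x)) x" for x
      unfolding degree_kernel_linear bD dD by simp
    then have "degree_integral (\<lambda>x. (1/e) *\<^sub>R (D *v x)) (ball 0 1) = det D * degree_integral (\<lambda>x::real^'n. (1/e) *\<^sub>R x) (ball 0 1)"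
      by (simp add: degree_integral_def)
    also have "degree_integral (\<lambda>x::real^'n. (1/e) *\<^sub>R x) (ball 0 1) = degree_unit TYPE('n)"
      unfolding degree_unit_def
    proof (rule degree_integral_rescale[where m=1])
      show "C2_field (\<lambda>x::real^'n. x)" by (rule C2_field_linear) (rule bounded_linear_ident)
    qed (use e in \<open>auto simp: field_simps\<close>)
    finally show "degree_integral (\<lambda>x. (1/e) *\<^sub>R (D *v x)) (ball 0 1) = sgn (det D) * degree_unit TYPE('n)"
      by (simp add: sgn1)
  qed
  then show ?thesis
  proof (rule linear_degree_sgn_homotopy)
    show "sgn (det D) = sgn (det A)"
      using det_diagonal[OF diag] by (simp add: sgn_prod detD)
    fix t :: real assume t: "t \<in> {0..1}"
    have "(1 - t) * sgn (A $ i $ i) + t * A $ i $ i \<noteq> 0" for i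
    proof (cases "A $ i $ i > 0")
      case True
      then show ?thesis using t by (cases "t = 0") (auto simp: add_nonneg_pos less_imp_neq[THEN not_sym])
    next
      case False
      then have "A $ i $ i < 0" using A[of i] by linarith
      then have "t = 0 \<or> t * A $ i $ i < 0" using t mult_pos_neg[of t "A $ i $ i"] by (cases "t = 0") auto
      then show ?thesis using t \<open>A $ i $ i < 0\<close> by auto
    qed
    then show "det ((1 - t) *\<^sub>R D + t *\<^sub>R A) \<noteq> 0"
      by (subst det_diagonal) (auto simp: D0 diag D_def)
  qed
qed

text \<open>The new matrix is \<open>A\<close> after a transposition of coordinates, which preserves
  Lebesgue measure and the unit ball; only the determinant in the kernel changes its sign.\<close>

lemma linear_degree_sgn_swap:
  fixes A :: "real^'n^'n"
  assumes A: "linear_degree_sgn A" and mn: "m \<noteq> n"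
  shows "linear_degree_sgn (\<chi> i j. A $ i $ Transposition.transpose m n j)"
proof -
  let ?\<tau> = "Transposition.transpose m n"
  let ?B = "\<chi> i j. A $ i $ ?\<tau> j" and ?\<pi> = "\<lambda>x::real^'n. \<chi> j. x $ ?\<tau> j"
  have \<tau>: "?\<tau> permutes UNIV" by (simp add: permutes_swap_id)
  have "continuous_on UNIV ?\<pi>" by (intro continuous_intros)
  then have [measurable]: "?\<pi> \<in> borel_measurable borel"
    using borel_measurable_continuous_onI by auto
  have sg: "sign ?\<tau> = -1" using mn by (simp add: sign_swap_id)
  have Bx: "?B *v x = A *v ?\<pi> x" for x
  proof -
    have "(\<Sum>j\<in>UNIV. A $ i $ ?\<tau> j * x $ j) = (\<Sum>j\<in>UNIV. A $ i $ j * x $ ?\<tau> j)" for i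
      using sum.permute[OF \<tau>, of "\<lambda>j. A $ i $ j * x $ ?\<tau> j"] by (simp add: o_def)
    then show ?thesis by (simp add: matrix_vector_mult_def)
  qed
  have detB: "det (\<chi> i j. C $ i $ ?\<tau> j) = - det C" for C :: "real^'n^'n"
    using det_permute_columns[OF \<tau>, of C] by (simp add: sg)
  have ker: "degree_kernel (\<lambda>x. (1/e) *\<^sub>R (?B *v x)) x = - degree_kernel (\<lambda>x. (1/e) *\<^sub>R (A *v x)) (?\<pi> x)" for e x
    unfolding degree_kernel_linear[of e ?B x] degree_kernel_linear[of e A "?\<pi> x"] Bx[of x] using detB[of "\<chi> i j. A $ i $ j / e"] by simp
  have normpi: "norm (?\<pi> x) = norm x" for x
    using sum.permute[OF \<tau>, of "\<lambda>j. (x $ j)\<^sup>2"] by (simp add: norm_vec_def L2_set_def o_def)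
  have "degree_integral (\<lambda>x. (1/e) *\<^sub>R (?B *v x)) (ball 0 1) = - degree_integral (\<lambda>x. (1/e) *\<^sub>R (A *v x)) (ball 0 1)" for e
  proof -
    let ?k = "degree_kernel (\<lambda>x. (1/e) *\<^sub>R (A *v x))"
    have [measurable]: "?k \<in> borel_measurable borel"
      by (intro borel_measurable_continuous_onI continuous_on_degree_kernel C2_field_scaleR C2_field_matrix)
    have "(LINT x:ball 0 1|lborel. ?k (?\<pi> x)) = (\<integral>x. indicator (ball 0 1) (?\<pi> x) *\<^sub>R ?k (?\<pi> x) \<partial>lborel)"
      unfolding set_lebesgue_integral_def by (simp add: indicator_def normpi)
    also have "\<dots> = (\<integral>x. indicator (ball 0 1) x *\<^sub>R ?k x \<partial>distr lborel borel ?\<pi>)"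
      by (intro integral_distr[symmetric] borel_measurable_scaleR borel_measurable_indicator) auto
    also have "\<dots> = degree_integral (\<lambda>x. (1/e) *\<^sub>R (A *v x)) (ball 0 1)"
      unfolding degree_integral_def set_lebesgue_integral_def lborel_distr_permute[OF \<tau>] ..
    moreover have "degree_integral (\<lambda>x. (1/e) *\<^sub>R (?B *v x)) (ball 0 1) = - (LINT x:ball 0 1|lborel. ?k (?\<pi> x))"
      unfolding degree_integral_def ker set_lebesgue_integral_def by simp
    ultimately show ?thesis by simp
  qed
  with A show ?thesis
    unfolding linear_degree_sgn_def detB by (auto simp: sgn_minus)
qed

text \<open>The induction reduces \<open>A\<close> to diagonal form by column swaps and row
  additions. Adding \<open>c\<close> times a row is a homotopy through the multiples
  \<open>t * c\<close>, along which the determinant is constant; a zero row contradicts the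
  premise.\<close>

lemma linear_degree_sgn:
  fixes A :: "real^'n^'n"
  assumes "det A \<noteq> 0"
  shows "linear_degree_sgn A"
proof -
  have "det A \<noteq> 0 \<longrightarrow> linear_degree_sgn A"
  proof (induction A rule: induct_matrix_row_operations)
    case (1 A i)
    then show ?case using det_zero_row by blast
  next
    case (2 A)
    then show ?case using linear_degree_sgn_diagonal by blast
  next
    case (3 A m n)
    have "det (\<chi> i j. A $ i $ Transposition.transpose m n j) = of_int (sign (Transposition.transpose m n)) * det A"
      by (rule det_permute_columns) (simp add: permutes_swap_id)
    with 3 show ?case using linear_degree_sgn_swap by auto
  next
    case (4 A m n c)
    let ?R = "\<lambda>c. \<chi> i. if i = m then row m A + c *\<^sub>R row n A else row i A"
    have det: "det (?R c) = det A" for c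
      using det_row_operation[OF 4(2), of A c] unfolding scalar_mult_eq_scaleR .
    have "linear_degree_sgn (?R c)" if "det A \<noteq> 0"
    proof (rule linear_degree_sgn_homotopy)
      show "linear_degree_sgn A" using 4 that by blast
      show "sgn (det A) = sgn (det (?R c))" by (simp add: det)
      fix t :: real
      have "(1 - t) *\<^sub>R A + t *\<^sub>R ?R c = ?R (t * c)"
        by (auto simp: vec_eq_iff row_def algebra_simps)
      then show "det ((1 - t) *\<^sub>R A + t *\<^sub>R ?R c) \<noteq> 0" using det that by simp
    qed
    then show ?case by (simp add: det)
  qed
  with assms show ?thesis by blast
qed

lemma matrix_vector_lower_bound:
  fixes A :: "real^'n^'n"
  assumes "det A \<noteq> 0"
  obtains m where "m > 0" "\<And>x. m * norm x \<le> norm (A *v x)"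
proof -
  have "inj ((*v) A)" using assms invertible_det_nz invertible_eq_bij bij_is_inj by blast
  then show ?thesis
    using linear_inj_bounded_below_pos[OF matrix_vector_mul_linear] that by (metis mult.commute)
qed

text \<open>The lower bound \<open>m\<close> for \<open>A\<close> confines the kernel, for small
  \<open>e\<close>, to the ball of radius \<open>min 1 r\<close>. After translation by
  \<open>c\<close> the balls of radius \<open>r\<close> and 1 thus give the same integral.\<close>

lemma degree_integral_affine_ball:
  fixes A :: "real^'n^'n"
  assumes A: "det A \<noteq> 0" and r: "r > 0"
  shows "\<exists>e0>0. \<forall>e. 0 < e \<and> e < e0 \<longrightarrow>
     degree_integral (\<lambda>x. (1/e) *\<^sub>R (A *v (x - c))) (ball c r) = sgn (det A) * degree_unit TYPE('n)"
proof -
  obtain e0 where e0: "e0 > 0" "\<And>e. 0 < e \<Longrightarrow> e < e0 \<Longrightarrow>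
     degree_integral (\<lambda>x. (1/e) *\<^sub>R (A *v x)) (ball 0 1) = sgn (det A) * degree_unit TYPE('n)"
    using linear_degree_sgn[OF A] by (auto simp: linear_degree_sgn_def)
  obtain m where m: "m > 0" "\<And>x. m * norm x \<le> norm (A *v x)"
    using matrix_vector_lower_bound[OF A] by blast
  let ?n = "real CARD('n)"
  show ?thesis
  proof (intro exI[of _ "min e0 (m * min 1 r / (2 * ?n))"] conjI allI impI)
    show "0 < min e0 (m * min 1 r / (2 * ?n))" using e0 m r by simp
    fix e assume e: "0 < e \<and> e < min e0 (m * min 1 r / (2 * ?n))"
    let ?k = "degree_kernel (\<lambda>x. (1/e) *\<^sub>R (A *v x))"
    have [measurable]: "?k \<in> borel_measurable borel"
      by (intro borel_measurable_continuous_onI continuous_on_degree_kernel C2_field_scaleR C2_field_matrix)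
    have k0: "?k x = 0" if "norm x \<ge> min 1 r" for x
    proof -
      have "2 * ?n * e < m * min 1 r" using e by (simp add: field_simps)
      also have "\<dots> \<le> m * norm x" using m that by simp
      also have "\<dots> \<le> norm (A *v x)" by (rule m)
      finally have "?n * (2 * e) < norm (A *v x)" by simp
      from exists_large_component[OF this] obtain j where "\<bar>(A *v x) $ j\<bar> > 2 * e" by blast
      then show ?thesis using e by (intro degree_kernel_0[of _ _ j]) (simp add: field_simps)
    qed
    have "degree_integral (\<lambda>x. (1/e) *\<^sub>R (A *v (x - c))) (ball c r) = (\<integral>x. indicator (ball c r) x *\<^sub>R ?k (x - c) \<partial>lborel)"
      unfolding degree_integral_def set_lebesgue_integral_def degree_kernel_affine degree_kernel_linear ..
    also have "\<dots> = (\<integral>x. indicator (ball c r) x *\<^sub>R ?k (x - c) \<partial>distr lborel borel ((+) c))"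
      by (simp add: lborel_distr_plus)
    also have "\<dots> = (\<integral>x. indicator (ball c r) (c + x) *\<^sub>R ?k (c + x - c) \<partial>lborel)"
      by (intro integral_distr borel_measurable_scaleR borel_measurable_indicator
          measurable_compose[where f="\<lambda>x. x - c" and g="?k" and N=borel]) auto
    also have "\<dots> = (\<integral>x. indicator (ball 0 1) x *\<^sub>R ?k x \<partial>lborel)"
      by (rule Bochner_Integration.integral_cong) (use k0 in \<open>auto simp: indicator_def dist_norm min_def split: if_splits\<close>)
    also have "\<dots> = sgn (det A) * degree_unit TYPE('n)"
      using e0(2)[of e] e by (simp add: degree_integral_def set_lebesgue_integral_def)
    finally show "degree_integral (\<lambda>x. (1/e) *\<^sub>R (A *v (x - c))) (ball c r) = sgn (det A) * degree_unit TYPE('n)" .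
  qed
qed

text \<open>The kernel of the identity is continuous, nonnegative and positive at 0. Positivity
  allows the unit to be cancelled in \<open>regular_degree_linear_homotopy\<close>, so that integers
  can be compared.\<close>

lemma degree_unit_pos: "degree_unit TYPE('n::finite) > 0"
proof -
  define d where "d = 1 / real (2 * CARD('n) + 1)"
  have d: "d > 0" by (simp add: d_def)
  let ?k = "degree_kernel (\<lambda>x::real^'n. (1/d) *\<^sub>R x)"
  have cont: "continuous_on UNIV ?k"
    by (intro continuous_on_degree_kernel C2_field_scaleR C2_field_linear bounded_linear_ident)
  have k: "?k x = (\<Prod>j\<in>UNIV. bump (x $ j / d)) * (\<Prod>j\<in>(UNIV::'n set). 1 / d)" for x
  proof -
    have "det (\<chi> j a. (mat 1 :: real^'n^'n) $ j $ a / d) = (\<Prod>j\<in>(UNIV::'n set). 1 / d)"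
      by (subst det_diagonal) (auto simp: mat_def)
    with degree_kernel_linear[of d "mat 1" x] show ?thesis by simp
  qed
  have k_nonneg: "?k x \<ge> 0" for x
    unfolding k using d by (intro mult_nonneg_nonneg prod_nonneg) (auto simp: bump_nonneg)
  have k0: "?k 0 > 0" unfolding k using d by (simp add: bump_0)
  have "isCont ?k 0" using cont by (simp add: continuous_on_eq_continuous_at)
  then obtain s where s: "s > 0" "\<And>x. dist x 0 < s \<Longrightarrow> dist (?k x) (?k 0) < ?k 0 / 2"
    using k0 unfolding continuous_at by (metis half_gt_zero continuous_at_eps_delta cont continuous_on_eq_continuous_at open_UNIV UNIV_I \<open>isCont ?k 0\<close>)
  let ?B = "ball (0::real^'n) (min s 1)"
  have "0 < (?k 0 / 2) * measure lborel ?B"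
    using k0 s content_ball_pos[of "min s 1" "0::real^'n"] by simp
  also have "\<dots> = (\<integral>x. (?k 0 / 2) * indicator ?B x \<partial>lborel)"
    by simp
  also have "\<dots> \<le> (\<integral>x. indicator (ball 0 1) x *\<^sub>R ?k x \<partial>lborel)"
  proof (rule integral_mono)
    show "integrable lborel (\<lambda>x. (?k 0 / 2) * indicator ?B x)"
      using emeasure_bounded_finite[of ?B] by (auto intro!: integrable_mult_right integrable_real_indicator)
    show "integrable lborel (\<lambda>x. indicator (ball 0 1) x *\<^sub>R ?k x)"
      using set_integrable_continuous_bounded[OF cont bounded_ball open_ball] by (simp add: set_integrable_def)
    show "(?k 0 / 2) * indicator ?B x \<le> indicator (ball 0 1) x *\<^sub>R ?k x" for x
    proof (cases "x \<in> ?B")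
      case True
      then have "dist x 0 < s" by simp
      from s(2)[OF this] have "?k 0 / 2 \<le> ?k x"
        unfolding dist_real_def by linarith
      with True show ?thesis by simp
    next
      case False
      then show ?thesis using k_nonneg[of x] by (auto simp: indicator_def)
    qed
  qed
  also have "\<dots> = degree_unit TYPE('n)"
    by (simp add: degree_unit_def degree_integral_def set_lebesgue_integral_def d_def)
  finally show ?thesis .
qed

subsection \<open>The degree integral counts nondegenerate zeros\<close>

definition regular_field :: "(real^'n \<Rightarrow> real^'n) \<Rightarrow> (real^'n) set \<Rightarrow> bool" where
  "regular_field G U \<longleftrightarrow> continuous_on (closure U) G \<and> (\<forall>x\<in>frontier U. G x \<noteq> 0) \<and>
     (\<forall>x\<in>U. G x = 0 \<longrightarrow> G differentiable (at x) \<and> det (jacobian G (at x)) \<noteq> 0)"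

text \<open>Turns a threshold at each zero into a common one. The element 1 in the minimum covers
  the case that \<open>Z\<close> is empty.\<close>

lemma finite_uniform_radius:
  assumes "finite Z" and "\<And>z. z \<in> Z \<Longrightarrow> \<exists>b>0. \<forall>r. 0 < r \<and> r < b \<longrightarrow> Q z (r::real)"
  obtains b where "b > 0" "\<And>z r. z \<in> Z \<Longrightarrow> 0 < r \<Longrightarrow> r < b \<Longrightarrow> Q z r"
proof -
  obtain b where b: "\<And>z. z \<in> Z \<Longrightarrow> b z > 0 \<and> (\<forall>r. 0 < r \<and> r < b z \<longrightarrow> Q z r)"
    using assms(2) by metis
  have fin: "finite (insert 1 (b ` Z))" using assms(1) by simp
  show ?thesis
  proof (rule that[of "Min (insert 1 (b ` Z))"])
    show "Min (insert 1 (b ` Z)) > 0" using fin b by (subst Min_gr_iff) auto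
    fix z r assume z: "z \<in> Z" "0 < r" "r < Min (insert 1 (b ` Z))"
    then have "r < b z" using fin by (subst (asm) Min_gr_iff) auto
    with z b show "Q z r" by blast
  qed
qed

lemma jacobian_approx:
  fixes G :: "real^'n \<Rightarrow> real^'m"
  assumes "G differentiable (at z)" "G z = 0" "e > 0"
  shows "\<exists>d>0. \<forall>y. dist z y < d \<longrightarrow> norm (G y - jacobian G (at z) *v (y - z)) \<le> e * dist z y"
proof -
  have "(G has_derivative (\<lambda>h. jacobian G (at z) *v h)) (at z)"
    using assms(1) jacobian_works by blast
  then have "\<forall>e>0. \<exists>d>0. \<forall>y. norm (y - z) < d \<longrightarrow> norm (G y - G z - jacobian G (at z) *v (y - z)) \<le> e * norm (y - z)"
    unfolding has_derivative_at_alt by blast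
  from this[rule_format, OF assms(3)] show ?thesis
    unfolding assms(2) by (simp add: dist_norm norm_minus_commute)
qed

text \<open>The zero set is compact, so if infinite it would accumulate at some zero
  \<open>z\<close>. With J the Jacobian there, a zero \<open>y\<close> near \<open>z\<close>
  satisfies \<open>c |y - z| \<le> |J (y - z)| \<le> c/2 |y - z|\<close>, which is impossible for
  \<open>y \<noteq> z\<close>.\<close>

lemma regular_field_finite_zeros:
  fixes G :: "real^'n \<Rightarrow> real^'n"
  assumes G: "regular_field G U" and U: "open U" "bounded U"
  shows "finite {x\<in>U. G x = 0}"
proof (rule ccontr)
  let ?Z = "{x\<in>U. G x = 0}"
  assume inf: "infinite ?Z"
  have eq: "?Z = closure U \<inter> G -` {0}"
  proof (intro set_eqI iffI)
    fix x assume x: "x \<in> closure U \<inter> G -` {0}"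
    then have "x \<notin> frontier U" using G by (auto simp: regular_field_def)
    with x U show "x \<in> ?Z" by (auto simp: frontier_def interior_open)
  qed (use closure_subset in auto)
  have "closed ?Z"
    unfolding eq by (rule continuous_closed_preimage) (use G in \<open>auto simp: regular_field_def\<close>)
  moreover have "bounded ?Z" by (rule bounded_subset[OF U(2)]) auto
  ultimately have "compact ?Z" by (simp add: compact_eq_bounded_closed)
  then have "\<exists>z\<in>?Z. z islimpt ?Z"
    unfolding compact_eq_Bolzano_Weierstrass using inf by blast
  then obtain z where z: "z \<in> ?Z" "z islimpt ?Z" by blast
  then have nz: "G differentiable (at z)" "G z = 0" "det (jacobian G (at z)) \<noteq> 0"
    using G unfolding regular_field_def by blast+
  obtain c where c: "c > 0" "\<And>h. c * norm h \<le> norm (jacobian G (at z) *v h)"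
    using matrix_vector_lower_bound[OF nz(3)] by blast
  obtain d where d: "d > 0" "\<And>y. dist z y < d \<Longrightarrow> norm (G y - jacobian G (at z) *v (y - z)) \<le> c / 2 * dist z y"
    using jacobian_approx[OF nz(1,2) half_gt_zero[OF c(1)]] by (elim exE conjE) (rule that, auto)
  obtain y where y: "y \<in> ?Z" "y \<noteq> z" "dist y z < d"
    using z(2) d(1) unfolding islimpt_approachable by blast
  then have "c * dist z y \<le> c / 2 * dist z y"
    using c(2)[of "y - z"] d(2)[of y] by (simp add: dist_commute) (simp add: dist_norm)
  moreover have "dist z y > 0" using y by simp
  ultimately show False using c(1) by simp
qed

lemma compact_norm_lower_bound:
  fixes G :: "'a::topological_space \<Rightarrow> 'b::real_normed_vector"
  assumes "compact R" "continuous_on R G" "\<And>x. x \<in> R \<Longrightarrow> G x \<noteq> 0"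
  obtains m where "m > 0" "\<And>x. x \<in> R \<Longrightarrow> m \<le> norm (G x)"
proof (cases "R = {}")
  case True
  then show ?thesis using that[of 1] by auto
next
  case False
  then obtain x where "x \<in> R" "\<And>y. y \<in> R \<Longrightarrow> norm (G x) \<le> norm (G y)"
    using continuous_attains_inf[OF assms(1) False continuous_on_norm[OF assms(2)]] by blast
  then show ?thesis using that[of "norm (G x)"] assms(3) by auto
qed

text \<open>\<open>P\<close> is a smooth stand-in for \<open>G\<close>, which need not have second
  derivatives. Away from the zeros of \<open>G\<close> the kernel of the scaled \<open>P\<close>
  vanishes; on a small ball about a zero \<open>z\<close>, \<open>P\<close> is joined to the
  linearisation of \<open>G\<close> at \<open>z\<close> without coming near 0 on the sphere.\<close>

lemma degree_integral_regular_field: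
  fixes G :: "real^'n \<Rightarrow> real^'n"
  assumes G: "regular_field G U" and U: "open U" "bounded U"
  shows "\<exists>\<mu>>0. \<forall>P. C2_field P \<and> (\<forall>x\<in>closure U. norm (P x - G x) < \<mu>) \<longrightarrow>
    (\<exists>e0>0. \<forall>e. 0 < e \<and> e < e0 \<longrightarrow>
      degree_integral (\<lambda>x. (1/e) *\<^sub>R P x) U = of_int (regular_degree G U) * degree_unit TYPE('n))"
proof -
  define Z where "Z = {x\<in>U. G x = 0}"
  let ?J = "\<lambda>z. jacobian G (at z)" and ?n = "real CARD('n)"
  have finZ: "finite Z" unfolding Z_def by (rule regular_field_finite_zeros[OF G U])
  have Z: "z \<in> U" "G z = 0" "G differentiable (at z)" "det (?J z) \<noteq> 0" if "z \<in> Z" for z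
    using that G by (auto simp: Z_def regular_field_def)
  obtain c1 where c1: "c1 > 0" "\<And>z r. z \<in> Z \<Longrightarrow> 0 < r \<Longrightarrow> r < c1 \<Longrightarrow> \<forall>h. r * norm h \<le> norm (?J z *v h)"
  proof (rule finite_uniform_radius[OF finZ, of "\<lambda>z r. \<forall>h. r * norm h \<le> norm (?J z *v h)"])
    fix z assume "z \<in> Z"
    with Z obtain b where b: "b > 0" "\<And>h. b * norm h \<le> norm (?J z *v h)"
      using matrix_vector_lower_bound by metis
    have "r * norm h \<le> norm (?J z *v h)" if "r < b" for r h
      by (rule order.trans[OF mult_right_mono[OF less_imp_le[OF that] norm_ge_zero] b(2)])
    then show "\<exists>b>0. \<forall>r. 0 < r \<and> r < b \<longrightarrow> (\<forall>h. r * norm h \<le> norm (?J z *v h))"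
      using b(1) by blast
  qed (rule that)
  define c where "c = c1 / 2"
  have c: "c > 0" "\<And>z h. z \<in> Z \<Longrightarrow> c * norm h \<le> norm (?J z *v h)"
    using c1(1) c1(2)[of _ "c1 / 2"] unfolding c_def by auto
  \<comment> \<open>The balls shall lie in \<open>U\<close>, be disjoint, and have a linearisation
    error of at most half the lower bound \<open>c\<close> for the Jacobians.\<close>
  let ?Q = "\<lambda>z r. cball z r \<subseteq> U \<and> (\<forall>z'\<in>Z. z' \<noteq> z \<longrightarrow> 2 * r < dist z z') \<and>
      (\<forall>y\<in>cball z r. norm (G y - ?J z *v (y - z)) \<le> c / 2 * dist z y)"
  obtain r1 where r1: "r1 > 0" "\<And>z r. z \<in> Z \<Longrightarrow> 0 < r \<Longrightarrow> r < r1 \<Longrightarrow> ?Q z r"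
  proof (rule finite_uniform_radius[OF finZ, of ?Q])
    fix z assume z: "z \<in> Z"
    obtain b1 where b1: "b1 > 0" "cball z b1 \<subseteq> U"
      using U(1) Z(1)[OF z] open_contains_cball by blast
    obtain b2 where b2: "b2 > 0" "\<And>z'. z' \<in> Z \<Longrightarrow> z' \<noteq> z \<Longrightarrow> b2 \<le> dist z z'"
      using finite_set_avoid[OF finZ, of z] by blast
    obtain b3 where b3: "b3 > 0" "\<And>y. dist z y < b3 \<Longrightarrow> norm (G y - ?J z *v (y - z)) \<le> c / 2 * dist z y"
      using jacobian_approx[OF Z(3)[OF z] Z(2)[OF z] half_gt_zero[OF c(1)]] by auto
    show "\<exists>b>0. \<forall>r. 0 < r \<and> r < b \<longrightarrow> ?Q z r"
    proof (intro exI[of _ "min b1 (min (b2/2) b3)"] conjI allI impI ballI)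
      fix r assume r: "0 < r \<and> r < min b1 (min (b2/2) b3)"
      then show "cball z r \<subseteq> U" using b1(2) by force
      show "2 * r < dist z z'" if "z' \<in> Z" "z' \<noteq> z" for z' using b2(2)[OF that] r by simp
      show "norm (G y - ?J z *v (y - z)) \<le> c / 2 * dist z y" if "y \<in> cball z r" for y
        using b3(2)[of y] that r by simp
    qed (use b1 b2 b3 in auto)
  qed (rule that)
  define r where "r = r1 / 2"
  have r: "r > 0" "\<And>z. z \<in> Z \<Longrightarrow> ?Q z r"
  proof -
    show "r > 0" using r1(1) by (simp add: r_def)
    show "?Q z r" if "z \<in> Z" for z
      by (rule r1(2)[OF that]) (use r1(1) in \<open>auto simp: r_def\<close>)
  qed
  define R where "R = closure U - (\<Union>z\<in>Z. ball z r)"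
  have "compact R"
    unfolding R_def using U by (intro compact_diff) (auto simp: compact_closure)
  moreover have "continuous_on R G"
    by (rule continuous_on_subset[of "closure U"]) (use G in \<open>auto simp: regular_field_def R_def\<close>)
  moreover have "G x \<noteq> 0" if "x \<in> R" for x
  proof (cases "x \<in> U")
    case True
    have "x \<notin> Z" using that r(1) by (auto simp: R_def)
    with True show ?thesis by (simp add: Z_def)
  next
    case False
    then have "x \<in> frontier U" using that U by (simp add: R_def frontier_def interior_open)
    then show ?thesis using G by (simp add: regular_field_def)
  qed
  ultimately obtain m where m: "m > 0" "\<And>x. x \<in> R \<Longrightarrow> m \<le> norm (G x)"
    using compact_norm_lower_bound by blast
  \<comment> \<open>\<open>m/2\<close> keeps \<open>P\<close> away from 0 outside the balls. On a
    sphere of radius \<open>r\<close> the linear part is at least \<open>c * r\<close>, its error at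
    most \<open>c * r / 2\<close>, and \<open>P - G\<close> costs at most \<open>c * r / 4\<close>,
    so \<open>c * r / 4\<close> remains.\<close>
  define \<mu> where "\<mu> = min (m/2) (c * r / 4)"
  have \<mu>: "\<mu> > 0" using m c r by (simp add: \<mu>_def)
  obtain e1 where e1: "e1 > 0" "\<And>z e. z \<in> Z \<Longrightarrow> 0 < e \<Longrightarrow> e < e1 \<Longrightarrow>
     degree_integral (\<lambda>x. (1/e) *\<^sub>R (?J z *v (x - z))) (ball z r) = sgn (det (?J z)) * degree_unit TYPE('n)"
  proof (rule finite_uniform_radius[OF finZ, of "\<lambda>z e. degree_integral (\<lambda>x. (1/e) *\<^sub>R (?J z *v (x - z))) (ball z r)
      = sgn (det (?J z)) * degree_unit TYPE('n)"])
    show "\<exists>b>0. \<forall>e. 0 < e \<and> e < b \<longrightarrow> degree_integral (\<lambda>x. (1/e) *\<^sub>R (?J z *v (x - z))) (ball z r)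
      = sgn (det (?J z)) * degree_unit TYPE('n)" if "z \<in> Z" for z
      by (rule degree_integral_affine_ball[OF Z(4)[OF that] r(1)])
  qed (rule that)
  have deg: "of_int (regular_degree G U) = (\<Sum>z\<in>Z. sgn (det (?J z)))"
    unfolding regular_degree_def Z_def[symmetric] of_int_sum
    by (rule sum.cong[OF refl]) (use Z(4) in \<open>force simp: sgn_if\<close>)
  show ?thesis
  proof (rule exI[of _ \<mu>], intro conjI allI impI)
    show "\<mu> > 0" by (rule \<mu>)
    fix P assume "C2_field P \<and> (\<forall>x\<in>closure U. norm (P x - G x) < \<mu>)"
    then have P: "C2_field P" "\<And>x. x \<in> closure U \<Longrightarrow> norm (P x - G x) < \<mu>" by auto
    show "\<exists>e0>0. \<forall>e. 0 < e \<and> e < e0 \<longrightarrow>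
      degree_integral (\<lambda>x. (1/e) *\<^sub>R P x) U = of_int (regular_degree G U) * degree_unit TYPE('n)"
    proof (intro exI[of _ "min e1 (\<mu> / (2 * ?n))"] conjI allI impI)
      show "0 < min e1 (\<mu> / (2 * ?n))" using e1(1) \<mu> by simp
      fix e assume e: "0 < e \<and> e < min e1 (\<mu> / (2 * ?n))"
      then have e': "2 * ?n * e < \<mu>" by (simp add: field_simps)
      let ?P = "\<lambda>x. (1/e) *\<^sub>R P x"
      have zero: "degree_kernel ?P x = 0" if "x \<in> R" for x
      proof -
        have "x \<in> closure U" using that by (auto simp: R_def)
        then have "norm (P x - G x) < m / 2" using P(2)[of x] by (simp add: \<mu>_def)
        then have "norm (P x) \<ge> m / 2"
          using m(2)[OF that] norm_triangle_sub[of "G x" "P x"] by (simp add: norm_minus_commute)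
        moreover have "?n * e < m / 2"
        proof -
          have "0 \<le> ?n * e" using e by simp
          then have "?n * e < \<mu>" using e' by linarith
          then show ?thesis by (simp add: \<mu>_def)
        qed
        ultimately have "norm (P x) > ?n * e" by linarith
        from exists_large_component[OF this] obtain j where "\<bar>P x $ j\<bar> > e" by blast
        then show ?thesis using e by (intro degree_kernel_0[of _ _ j]) (simp add: field_simps)
      qed
      have sub: "(\<Union>z\<in>Z. ball z r) \<subseteq> U"
        using r(2) ball_subset_cball by blast
      have "degree_integral ?P U = degree_integral ?P (\<Union>z\<in>Z. ball z r)"
        unfolding degree_integral_def set_lebesgue_integral_def
      proof (rule Bochner_Integration.integral_cong[OF refl])
        fix x show "indicator U x *\<^sub>R degree_kernel ?P x = indicator (\<Union>z\<in>Z. ball z r) x *\<^sub>R degree_kernel ?P x"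
        proof (cases "x \<in> R")
          case True
          then show ?thesis using zero by simp
        next
          case False
          then have "x \<in> U \<longleftrightarrow> x \<in> (\<Union>z\<in>Z. ball z r)"
            using sub closure_subset[of U] unfolding R_def by blast
          then show ?thesis by (simp add: indicator_def)
        qed
      qed
      also have "\<dots> = (\<Sum>z\<in>Z. degree_integral ?P (ball z r))"
        unfolding degree_integral_def
      proof (rule set_integral_finite_Union[OF finZ])
        show "disjoint_family_on (\<lambda>z. ball z r) Z"
        proof (unfold disjoint_family_on_def, intro ballI impI)
          fix z z' assume "z \<in> Z" "z' \<in> Z" "z \<noteq> z'"
          then have "2 * r < dist z z'" using r(2) by auto
          then show "ball z r \<inter> ball z' r = {}"
            by (intro disjoint_ballI) auto
        qed
        show "set_integrable lborel (ball z r) (degree_kernel ?P)" for z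
          by (intro set_integrable_degree_kernel C2_field_scaleR P) auto
      qed auto
      also have "\<dots> = (\<Sum>z\<in>Z. sgn (det (?J z)) * degree_unit TYPE('n))"
      proof (rule sum.cong[OF refl])
        fix z assume z: "z \<in> Z"
        have "degree_integral ?P (ball z r) = degree_integral (\<lambda>x. (1/e) *\<^sub>R (?J z *v (x - z))) (ball z r)"
        proof (rule degree_integral_homotopy_scaled[OF P(1) _ open_ball bounded_ball, where m=\<mu>])
          show "C2_field (\<lambda>x. ?J z *v (x - z))"
            unfolding matrix_vector_mult_diff_distrib
            by (intro C2_field_diff C2_field_matrix C2_field_const)
          fix x and t :: real assume x: "x \<in> frontier (ball z r)" and t: "t \<in> {0..1}"
          let ?L = "?J z *v (x - z)"
          have xr: "dist z x = r" using x r(1) by simp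
          have "x \<in> cball z r" using xr by simp
          then have 1: "norm (G x - ?L) \<le> c * r / 2" and "x \<in> U"
            using r(2)[OF z] xr by auto
          then have 2: "norm (P x - G x) < c * r / 4" using P(2)[of x] closure_subset[of U] by (auto simp: \<mu>_def)
          have 3: "norm ?L \<ge> c * r" using c(2)[OF z, of "x - z"] xr by (simp add: dist_norm norm_minus_commute)
          have eq: "(1 - t) *\<^sub>R P x + t *\<^sub>R ?L = ?L + (1 - t) *\<^sub>R (P x - ?L)"
            by (simp add: algebra_simps)
          have "norm ((1 - t) *\<^sub>R (P x - ?L)) \<le> norm (P x - ?L)"
            using t by (simp add: mult_left_le_one_le)
          also have "\<dots> \<le> norm (P x - G x) + norm (G x - ?L)"
            using norm_triangle_ineq[of "P x - G x" "G x - ?L"] by simp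
          finally have "norm ((1 - t) *\<^sub>R (P x - ?L)) \<le> 3 * (c * r) / 4"
            using 1 2 by linarith
          then have "norm ((1 - t) *\<^sub>R P x + t *\<^sub>R ?L) \<ge> c * r / 4"
            unfolding eq using 3 norm_diff_ineq[of ?L "(1 - t) *\<^sub>R (P x - ?L)"] by linarith
          then show "\<mu> \<le> norm ((1 - t) *\<^sub>R P x + t *\<^sub>R ?L)" by (simp add: \<mu>_def)
        qed (use e e' in auto)
        also have "\<dots> = sgn (det (?J z)) * degree_unit TYPE('n)"
          using e1(2)[OF z] e by simp
        finally show "degree_integral ?P (ball z r) = sgn (det (?J z)) * degree_unit TYPE('n)" .
      qed
      also have "\<dots> = of_int (regular_degree G U) * degree_unit TYPE('n)"
        by (simp add: deg sum_distrib_right)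
      finally show "degree_integral ?P U = of_int (regular_degree G U) * degree_unit TYPE('n)" .
    qed
  qed
qed

text \<open>Both fields are replaced by polynomials, between which the degree integral is invariant.
  At one common scale \<open>e\<close> it equals either degree times
  \<open>degree_unit\<close>.\<close>

lemma regular_degree_linear_homotopy:
  fixes G G' :: "real^'n \<Rightarrow> real^'n"
  assumes G: "regular_field G U" "regular_field G' U" and U: "open U" "bounded U" and m: "m > 0"
    and fr: "\<And>x t. x \<in> frontier U \<Longrightarrow> t \<in> {0..1} \<Longrightarrow> norm ((1 - t) *\<^sub>R G x + t *\<^sub>R G' x) \<ge> m"
  shows "regular_degree G U = regular_degree G' U"
proof -
  let ?n = "real CARD('n)" and ?u = "degree_unit TYPE('n)"
  obtain \<mu> where \<mu>: "\<mu> > 0" "\<forall>P. C2_field P \<and> (\<forall>x\<in>closure U. norm (P x - G x) < \<mu>) \<longrightarrow>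
    (\<exists>e0>0. \<forall>e. 0 < e \<and> e < e0 \<longrightarrow> degree_integral (\<lambda>x. (1/e) *\<^sub>R P x) U = of_int (regular_degree G U) * ?u)"
    using degree_integral_regular_field[OF G(1) U] by (elim exE conjE) (rule that)
  obtain \<mu>' where \<mu>': "\<mu>' > 0" "\<forall>P. C2_field P \<and> (\<forall>x\<in>closure U. norm (P x - G' x) < \<mu>') \<longrightarrow>
    (\<exists>e0>0. \<forall>e. 0 < e \<and> e < e0 \<longrightarrow> degree_integral (\<lambda>x. (1/e) *\<^sub>R P x) U = of_int (regular_degree G' U) * ?u)"
    using degree_integral_regular_field[OF G(2) U] by (elim exE conjE) (rule that)
  \<comment> \<open>\<open>\<mu>\<close> and \<open>\<mu>'\<close> allow the zeros to be counted;
    \<open>m/2\<close> leaves at least \<open>m/2\<close> of the frontier estimate for the segment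
    from \<open>P\<close> to \<open>P'\<close>.\<close>
  define \<delta> where "\<delta> = min (min \<mu> \<mu>') (m/2)"
  have \<delta>: "\<delta> > 0" "\<delta> \<le> \<mu>" "\<delta> \<le> \<mu>'" "\<delta> \<le> m/2" using \<mu> \<mu>' m by (auto simp: \<delta>_def)
  have cpt: "compact (closure U)" using U by simp
  obtain P where P: "C2_field P" "\<And>x. x \<in> closure U \<Longrightarrow> norm (P x - G x) < \<delta>"
  proof -
    have "continuous_on (closure U) G" using G(1) by (simp add: regular_field_def)
    from Stone_Weierstrass_polynomial_function[OF cpt this \<delta>(1)] show ?thesis
      using that C2_field_polynomial by (auto simp: norm_minus_commute)
  qed
  obtain P' where P': "C2_field P'" "\<And>x. x \<in> closure U \<Longrightarrow> norm (P' x - G' x) < \<delta>"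
  proof -
    have "continuous_on (closure U) G'" using G(2) by (simp add: regular_field_def)
    from Stone_Weierstrass_polynomial_function[OF cpt this \<delta>(1)] show ?thesis
      using that C2_field_polynomial by (auto simp: norm_minus_commute)
  qed
  obtain e0 where e0: "e0 > 0" "\<And>e. 0 < e \<Longrightarrow> e < e0 \<Longrightarrow>
      degree_integral (\<lambda>x. (1/e) *\<^sub>R P x) U = of_int (regular_degree G U) * ?u"
  proof -
    have "\<forall>x\<in>closure U. norm (P x - G x) < \<mu>"
      using less_le_trans[OF P(2) \<delta>(2)] by blast
    with P(1) have "C2_field P \<and> (\<forall>x\<in>closure U. norm (P x - G x) < \<mu>)" by blast
    from \<mu>(2)[THEN spec, THEN mp, OF this] show ?thesis
      by (elim exE conjE) (rule that, auto)
  qed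
  obtain e0' where e0': "e0' > 0" "\<And>e. 0 < e \<Longrightarrow> e < e0' \<Longrightarrow>
      degree_integral (\<lambda>x. (1/e) *\<^sub>R P' x) U = of_int (regular_degree G' U) * ?u"
  proof -
    have "\<forall>x\<in>closure U. norm (P' x - G' x) < \<mu>'"
      using less_le_trans[OF P'(2) \<delta>(3)] by blast
    with P'(1) have "C2_field P' \<and> (\<forall>x\<in>closure U. norm (P' x - G' x) < \<mu>')" by blast
    from \<mu>'(2)[THEN spec, THEN mp, OF this] show ?thesis
      by (elim exE conjE) (rule that, auto)
  qed
  have "0 < min (min e0 e0') (m / (4 * ?n))" using e0(1) e0'(1) m by simp
  from dense[OF this] obtain e where e: "0 < e" "e < e0" "e < e0'" and "e < m / (4 * ?n)"
    by (auto simp: min_less_iff_conj)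
  then have e': "2 * ?n * e < m / 2" by (simp add: field_simps)
  have "degree_integral (\<lambda>x. (1/e) *\<^sub>R P x) U = degree_integral (\<lambda>x. (1/e) *\<^sub>R P' x) U"
  proof (rule degree_integral_homotopy_scaled[OF P(1) P'(1) U _ e(1) e'])
    fix x and t :: real assume x: "x \<in> frontier U" and t: "t \<in> {0..1}"
    then have xc: "x \<in> closure U" by (auto simp: frontier_def)
    have eq: "(1 - t) *\<^sub>R G x + t *\<^sub>R G' x
       = ((1 - t) *\<^sub>R P x + t *\<^sub>R P' x) + ((1 - t) *\<^sub>R (G x - P x) + t *\<^sub>R (G' x - P' x))"
      by (simp add: algebra_simps)
    have "norm ((1 - t) *\<^sub>R (G x - P x) + t *\<^sub>R (G' x - P' x)) \<le> (1 - t) * (m/2) + t * (m/2)"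
    proof (rule norm_triangle_le, rule add_mono)
      show "norm ((1 - t) *\<^sub>R (G x - P x)) \<le> (1 - t) * (m/2)"
        unfolding norm_scaleR by (rule mult_mono) (use P(2)[OF xc] \<delta>(4) t in \<open>auto simp: norm_minus_commute\<close>)
      show "norm (t *\<^sub>R (G' x - P' x)) \<le> t * (m/2)"
        unfolding norm_scaleR by (rule mult_mono) (use P'(2)[OF xc] \<delta>(4) t in \<open>auto simp: norm_minus_commute\<close>)
    qed
    moreover have "(1 - t) * (m/2) + t * (m/2) = m/2" by (simp add: field_simps)
    ultimately show "m / 2 \<le> norm ((1 - t) *\<^sub>R P x + t *\<^sub>R P' x)"
      using fr[OF x t, unfolded eq] norm_triangle_ineq[of "(1 - t) *\<^sub>R P x + t *\<^sub>R P' x" "(1 - t) *\<^sub>R (G x - P x) + t *\<^sub>R (G' x - P' x)"]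
      by linarith
  qed
  then have "of_int (regular_degree G U) * ?u = of_int (regular_degree G' U) * ?u"
    unfolding e0(2)[OF e(1,2)] e0'(2)[OF e(1,3)] .
  then show ?thesis using degree_unit_pos[where 'n='n] by simp
qed

subsection \<open>Existence of regular approximations\<close>

text \<open>The library proves Sard's theorem only for well-ordered index types, so it is transported
  along a well-ordered copy of the index type.\<close>

typedef 'a wo_copy = "UNIV :: 'a set" by simp

instance wo_copy :: (finite) finite
proof
  have "(UNIV :: 'a wo_copy set) = Abs_wo_copy ` UNIV"
    by (metis Rep_wo_copy_inverse surjI)
  then show "finite (UNIV :: 'a wo_copy set)" by (metis finite finite_imageI)
qed

definition wo_index :: "'a::finite wo_copy \<Rightarrow> nat" where
  "wo_index = (SOME f. inj f)"

lemma inj_wo_index: "inj wo_index"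
proof -
  have "\<exists>f :: 'a wo_copy \<Rightarrow> nat. inj f"
    using finite_imp_inj_to_nat_seg[of "UNIV :: 'a wo_copy set"] by auto
  then show ?thesis unfolding wo_index_def by (rule someI_ex)
qed

instantiation wo_copy :: (finite) wellorder
begin

definition less_eq_wo_copy :: "'a wo_copy \<Rightarrow> 'a wo_copy \<Rightarrow> bool" where
  "less_eq_wo_copy x y \<longleftrightarrow> wo_index x \<le> wo_index y"

definition less_wo_copy :: "'a wo_copy \<Rightarrow> 'a wo_copy \<Rightarrow> bool" where
  "less_wo_copy x y \<longleftrightarrow> wo_index x < wo_index y"

instance
proof
  fix P :: "'a wo_copy \<Rightarrow> bool" and a
  assume *: "\<And>x. (\<And>y. y < x \<Longrightarrow> P y) \<Longrightarrow> P x"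
  show "P a"
    by (induction a rule: measure_induct_rule[of wo_index]) (use * in \<open>auto simp: less_wo_copy_def\<close>)
qed (auto simp: less_eq_wo_copy_def less_wo_copy_def dest: injD[OF inj_wo_index])

end

text \<open>\<open>\<Phi>\<close> and \<open>\<Psi>\<close> rename coordinates and are mutually
  inverse, so non-injectivity of the derivative survives conjugation. The null set is carried back
  by \<open>\<Psi>\<close>, a linear map between spaces of equal dimension.\<close>

lemma negligible_critical_values:
  fixes f :: "real^'n \<Rightarrow> real^'n"
  assumes der: "\<And>x. x \<in> S \<Longrightarrow> (f has_derivative f' x) (at x)"
    and sing: "\<And>x. x \<in> S \<Longrightarrow> \<not> inj (f' x)"
  shows "negligible (f ` S)"
proof -
  define \<Phi> where "\<Phi> x = (\<chi> i. x $ Rep_wo_copy i)" for x :: "real^'n"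
  define \<Psi> where "\<Psi> x = (\<chi> i. x $ Abs_wo_copy i)" for x :: "real^'n wo_copy"
  have inv: "\<Psi> (\<Phi> x) = x" "\<Phi> (\<Psi> y) = y" for x y
    by (simp_all add: \<Phi>_def \<Psi>_def vec_eq_iff Abs_wo_copy_inverse Rep_wo_copy_inverse)
  have lin: "linear \<Phi>" "linear \<Psi>"
    by (auto intro!: linearI simp: \<Phi>_def \<Psi>_def vec_eq_iff)
  then have bl: "bounded_linear \<Phi>" "bounded_linear \<Psi>"
    using linear_conv_bounded_linear by blast+
  have "negligible ((\<lambda>y. \<Phi> (f (\<Psi> y))) ` (\<Phi> ` S))"
  proof (rule baby_Sard[where f'="\<lambda>y h. \<Phi> (f' (\<Psi> y) (\<Psi> h))"])
    fix y assume "y \<in> \<Phi> ` S"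
    then have y: "\<Psi> y \<in> S" using inv by auto
    have "((\<lambda>y. f (\<Psi> y)) has_derivative (\<lambda>h. f' (\<Psi> y) (\<Psi> h))) (at y within \<Phi> ` S)"
      using has_derivative_compose[OF bounded_linear.has_derivative[OF bl(2) has_derivative_ident] der[OF y]] .
    then show d: "((\<lambda>y. \<Phi> (f (\<Psi> y))) has_derivative (\<lambda>h. \<Phi> (f' (\<Psi> y) (\<Psi> h)))) (at y within \<Phi> ` S)"
      by (rule bounded_linear.has_derivative[OF bl(1)])
    obtain a b where ab: "a \<noteq> b" "f' (\<Psi> y) a = f' (\<Psi> y) b"
      using sing[OF y] by (auto simp: inj_def)
    have "matrix (\<lambda>h. \<Phi> (f' (\<Psi> y) (\<Psi> h))) *v h = \<Phi> (f' (\<Psi> y) (\<Psi> h))" for h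
      using fun_cong[OF matrix_vector_mul(2)[OF has_derivative_linear[OF d]]] .
    then have "\<not> inj ((*v) (matrix (\<lambda>h. \<Phi> (f' (\<Psi> y) (\<Psi> h)))))"
      using ab inv unfolding inj_def by metis
    then show "rank (matrix (\<lambda>h. \<Phi> (f' (\<Psi> y) (\<Psi> h)))) < CARD('n wo_copy)"
      by (simp add: less_rank_noninjective)
  qed simp
  then have "negligible (\<Psi> ` (\<lambda>y. \<Phi> (f (\<Psi> y))) ` (\<Phi> ` S))"
  proof (rule negligible_differentiable_image_negligible[rotated])
    show "\<Psi> differentiable_on (\<lambda>y. \<Phi> (f (\<Psi> y))) ` (\<Phi> ` S)"
      by (rule bounded_linear_imp_differentiable_on[OF bl(2)])
    have "bij (Abs_wo_copy :: 'n \<Rightarrow> _)"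
      by (rule bij_betw_byWitness[where f'=Rep_wo_copy]) (auto simp: Abs_wo_copy_inverse Rep_wo_copy_inverse)
    then show "DIM((real, 'n wo_copy) vec) \<le> DIM((real, 'n) vec)"
      using bij_betw_same_card by (metis DIM_cart DIM_real le_refl)
  qed
  then show ?thesis by (simp add: image_image inv)
qed

lemma jacobian_component:
  fixes p :: "real^'n \<Rightarrow> real^'m"
  assumes "p differentiable (at x)"
  shows "jacobian p (at x) $ j $ a = grad a (\<lambda>x. p x $ j) x"
proof -
  have "(p has_derivative (\<lambda>h. jacobian p (at x) *v h)) (at x)"
    using assms jacobian_works by blast
  then have "((\<lambda>x. p x $ j) has_derivative (\<lambda>h. (jacobian p (at x) *v h) $ j)) (at x)"
    by (rule bounded_linear.has_derivative[OF bounded_linear_vec_nth])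
  from grad_eqI[OF this] show ?thesis
    by (simp add: matrix_vector_mult_basis column_def)
qed

lemma C2_field_differentiable:
  assumes "C2_field p"
  shows "p differentiable (at x)"
proof -
  have "(p has_derivative (\<lambda>h. \<chi> j. \<Sum>a\<in>UNIV. grad a (\<lambda>x. p x $ j) x * h $ a)) (at x)"
    unfolding has_derivative_componentwise_within[of p]
    using has_derivative_grad[OF C2D(1)[OF C2_fieldD[OF assms]]]
    by (auto simp: Basis_vec_def inner_axis)
  then show ?thesis by (auto simp: differentiable_def)
qed

text \<open>A polynomial \<open>p\<close> uses up half of \<open>\<delta>\<close>, the shift by a
  regular value \<open>y\<close> of \<open>p\<close> the other half. Such a \<open>y\<close> exists
  in the ball of radius \<open>\<delta>/2\<close> because the critical values are negligible and the
  ball is not; the shift keeps the Jacobian and makes 0 a regular value.\<close>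

lemma exists_regular_approx:
  fixes F :: "real^'n \<Rightarrow> real^'n"
  assumes F: "continuous_on (closure U) F" and U: "bounded U" and \<delta>: "\<delta> > 0"
  shows "\<exists>G. regular_approx G F U \<delta>"
proof -
  have cpt: "compact (closure U)" using U by simp
  obtain p where "polynomial_function p" and pF: "\<And>x. x \<in> closure U \<Longrightarrow> norm (F x - p x) < \<delta>/2"
    using Stone_Weierstrass_polynomial_function[OF cpt F half_gt_zero[OF \<delta>]] by blast
  then have p: "C2_field p" by (simp add: C2_field_polynomial)
  let ?S = "{x. det (jacobian p (at x)) = 0}"
  have "negligible (p ` ?S)"
  proof (rule negligible_critical_values)
    show "(p has_derivative (\<lambda>h. jacobian p (at x) *v h)) (at x)" for x
      using C2_field_differentiable[OF p] jacobian_works by blast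
    show "\<not> inj ((*v) (jacobian p (at x)))" if "x \<in> ?S" for x
      using that det_nz_iff_inj[OF matrix_vector_mul_linear[of "jacobian p (at x)"]] by simp
  qed
  moreover have "\<not> negligible (ball (0::real^'n) (\<delta>/2))"
    using \<delta> open_not_negligible[of "ball (0::real^'n) (\<delta>/2)"] by auto
  ultimately have "\<not> ball 0 (\<delta>/2) \<subseteq> p ` ?S"
    using negligible_subset by blast
  then obtain y where "y \<in> ball 0 (\<delta>/2)" and yS: "y \<notin> p ` ?S" by blast
  then have y: "norm y < \<delta>/2" "y \<notin> p ` ?S" by simp_all
  let ?G = "\<lambda>x. p x - y"
  have G: "C2_field ?G" by (intro C2_field_diff C2_field_const p)
  have jG: "jacobian ?G (at x) = jacobian p (at x)" for x
  proof -
    have "grad a (\<lambda>x. ?G x $ j) x = grad a (\<lambda>x. p x $ j) x" for a j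
      using grad_diff[OF C2D(1)[OF C2_fieldD[OF p]], of "\<lambda>x. y $ j" x a j]
      by (simp add: grad_const)
    then show ?thesis
      using jacobian_component[OF C2_field_differentiable[OF G]] jacobian_component[OF C2_field_differentiable[OF p]]
      by (simp add: vec_eq_iff)
  qed
  have "jacobian p (at x) = (\<chi> j a. grad a (\<lambda>x. p x $ j) x)" for x
    using jacobian_component[OF C2_field_differentiable[OF p]] by (simp add: vec_eq_iff)
  then have "continuous_on U (\<lambda>x. jacobian p (at x))"
    using C2D(5)[OF C2_fieldD[OF p]] by (auto intro!: continuous_intros intro: continuous_on_subset)
  moreover have "norm (?G x - F x) < \<delta>" if "x \<in> closure U" for x
  proof -
    have "norm (?G x - F x) \<le> norm (p x - F x) + norm y"
      using norm_triangle_ineq4[of "p x - F x" y] by (simp add: algebra_simps)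
    then show ?thesis
      using pF[OF that] y(1) unfolding norm_minus_commute[of "p x" "F x"] by linarith
  qed
  ultimately have "regular_approx ?G F U \<delta>"
    unfolding regular_approx_def jG
    using C2_field_continuous[OF G] C2_field_differentiable[OF G] y(2) by auto
  then show ?thesis by blast
qed

subsection \<open>Homotopy invariance of the Brouwer degree\<close>

lemma regular_approx_imp_regular_field:
  assumes "regular_approx G F U \<delta>" "\<And>x. x \<in> frontier U \<Longrightarrow> \<delta> \<le> norm (F x)"
  shows "regular_field G U"
  unfolding regular_field_def
proof (intro conjI ballI impI)
  fix x assume x: "x \<in> frontier U"
  then have "x \<in> closure U" by (auto simp: frontier_def)
  then have "norm (G x - F x) < \<delta>" using assms(1) by (simp add: regular_approx_def)
  with assms(2)[OF x] show "G x \<noteq> 0" by auto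
qed (use assms(1) in \<open>auto simp: regular_approx_def\<close>)

text \<open>On the frontier the segment has a lower bound \<open>m\<close>. Approximations within
  \<open>m/4\<close> retain at least \<open>m/2\<close> of it, so for either field they all have the
  same regular degree, and both definite descriptions yield that of a single approximation
  \<open>G0\<close>.\<close>

lemma brouwer_degree_linear_homotopy:
  fixes F0 F1 :: "real^'n \<Rightarrow> real^'n"
  assumes U: "open U" "bounded U" and F: "continuous_on (closure U) F0" "continuous_on (closure U) F1"
    and nz: "\<And>x t. x \<in> frontier U \<Longrightarrow> t \<in> {0..1} \<Longrightarrow> (1 - t) *\<^sub>R F0 x + t *\<^sub>R F1 x \<noteq> 0"
  shows "brouwer_degree F0 U = brouwer_degree F1 U"
proof -
  let ?H = "\<lambda>(t, x). (1 - t) *\<^sub>R F0 x + t *\<^sub>R F1 x"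
  have "compact ({0..1::real} \<times> frontier U)" using U by (intro compact_Times) auto
  moreover have "continuous_on ({0..1::real} \<times> frontier U) ?H"
    unfolding case_prod_beta
    by (intro continuous_intros continuous_on_compose2[OF F(1), of _ snd] continuous_on_compose2[OF F(2), of _ snd])
      (auto simp: frontier_def)
  moreover have "?H z \<noteq> 0" if "z \<in> {0..1::real} \<times> frontier U" for z
    using nz that by auto
  ultimately obtain m where m: "m > 0" "\<And>z. z \<in> {0..1::real} \<times> frontier U \<Longrightarrow> m \<le> norm (?H z)"
    using compact_norm_lower_bound by blast
  have H: "m \<le> norm ((1 - t) *\<^sub>R F0 x + t *\<^sub>R F1 x)" if "x \<in> frontier U" "t \<in> {0..1}" for x t
    using m(2)[of "(t, x)"] that by simp
  have F0: "m \<le> norm (F0 x)" and F1: "m \<le> norm (F1 x)" if "x \<in> frontier U" for x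
    using H[OF that, of 0] H[OF that, of 1] by auto
  define d where "d = m / 4"
  have d: "d > 0" using m by (simp add: d_def)
  have rf: "regular_field G U" if "regular_approx G F U d" "F = F0 \<or> F = F1" for F G
    using regular_approx_imp_regular_field[OF that(1)] that(2) F0 F1 m(1) by (force simp: d_def)
  have close: "norm (G x - F x) < d" if "regular_approx G F U d" "x \<in> frontier U" for G F x
    using that by (auto simp: regular_approx_def frontier_def)
  \<comment> \<open>The case \<open>B = F0\<close> gives independence of the approximation, the case
    \<open>B = F1\<close> the comparison of the two fields.\<close>
  have eq: "regular_degree G U = regular_degree G' U"
    if G: "regular_approx G A U d" "regular_approx G' B U d" and AB: "A = F0" "B = F0 \<or> B = F1" for G G' A B
  proof (rule regular_degree_linear_homotopy[OF rf[OF G(1)] rf[OF G(2)] U])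
    show "A = F0 \<or> A = F1" "B = F0 \<or> B = F1" using AB by auto
    show "m / 2 > 0" using m by simp
    fix x and t :: real assume x: "x \<in> frontier U" and t: "t \<in> {0..1}"
    have "m \<le> norm ((1 - t) *\<^sub>R A x + t *\<^sub>R B x)"
    proof (cases "B = F1")
      case True
      then show ?thesis using H[OF x t] AB by simp
    next
      case False
      then have "B = F0" using AB by simp
      then have "(1 - t) *\<^sub>R A x + t *\<^sub>R B x = F0 x" using AB by (simp add: algebra_simps)
      then show ?thesis using F0[OF x] by simp
    qed
    moreover have "(1 - t) *\<^sub>R A x + t *\<^sub>R B x
       = ((1 - t) *\<^sub>R G x + t *\<^sub>R G' x) - ((1 - t) *\<^sub>R (G x - A x) + t *\<^sub>R (G' x - B x))"
      by (simp add: algebra_simps)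
    moreover have "norm ((1 - t) *\<^sub>R (G x - A x) + t *\<^sub>R (G' x - B x)) \<le> (1 - t) * d + t * d"
    proof (rule norm_triangle_le, rule add_mono)
      show "norm ((1 - t) *\<^sub>R (G x - A x)) \<le> (1 - t) * d"
        unfolding norm_scaleR by (rule mult_mono) (use close[OF G(1) x] t in auto)
      show "norm (t *\<^sub>R (G' x - B x)) \<le> t * d"
        unfolding norm_scaleR by (rule mult_mono) (use close[OF G(2) x] t in auto)
    qed
    moreover have "(1 - t) * d + t * d = m / 4" by (simp add: field_simps d_def)
    ultimately show "m / 2 \<le> norm ((1 - t) *\<^sub>R G x + t *\<^sub>R G' x)"
      using norm_triangle_ineq4[of "(1 - t) *\<^sub>R G x + t *\<^sub>R G' x" "(1 - t) *\<^sub>R (G x - A x) + t *\<^sub>R (G' x - B x)"] m(1)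
      by simp
  qed
  obtain G0 where G0: "regular_approx G0 F0 U d"
    using exists_regular_approx[OF F(1) U(2) d] by blast
  have "brouwer_degree F U = regular_degree G0 U" if FF: "F = F0 \<or> F = F1" for F
    unfolding brouwer_degree_def
  proof (rule the_equality)
    show "\<exists>\<delta>>0. \<forall>G. regular_approx G F U \<delta> \<longrightarrow> regular_degree G U = regular_degree G0 U"
      using eq[OF G0 _ refl FF] d by metis
    \<comment> \<open>A competing value \<open>k\<close> may come with another tolerance
      \<open>\<delta>\<close>; an existing approximation within \<open>min \<delta> d\<close>
      satisfies both and determines \<open>k\<close>.\<close>
    fix k assume "\<exists>\<delta>>0. \<forall>G. regular_approx G F U \<delta> \<longrightarrow> regular_degree G U = k"
    then obtain \<delta> where \<delta>: "\<delta> > 0" "\<And>G. regular_approx G F U \<delta> \<Longrightarrow> regular_degree G U = k" by blast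
    have "continuous_on (closure U) F" using FF F by auto
    from exists_regular_approx[OF this U(2), of "min \<delta> d"] obtain G where G: "regular_approx G F U (min \<delta> d)"
      using \<delta> d by auto
    then have "regular_approx G F U \<delta>" "regular_approx G F U d" by (auto simp: regular_approx_def)
    then show "k = regular_degree G0 U" using \<delta>(2) eq[OF G0 _ refl FF] by metis
  qed
  then show ?thesis by simp
qed

subsection \<open>Gronwall estimates\<close>

text \<open>The differential inequality is assumed only while \<open>v \<le> 1\<close>, as befits a
  field that is Lipschitz only near a given solution. Since the resulting bound is below 1,
  \<open>v\<close> never reaches the level 1 and the inequality stays available.\<close>

lemma gronwall_below_1:
  fixes v :: "real \<Rightarrow> real"
  assumes M: "M \<ge> 0" and b: "b \<ge> 0"
    and der: "\<And>t. t \<in> {0..T} \<Longrightarrow> (v has_real_derivative v' t) (at t)"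
    and le: "\<And>t. t \<in> {0..T} \<Longrightarrow> v t \<le> 1 \<Longrightarrow> v' t \<le> M * v t + b"
    and small: "(v 0 + b * T) * exp (M * T) < 1" and v0: "v 0 \<ge> 0" and t: "t \<in> {0..T}"
  shows "v t \<le> (v 0 + b * T) * exp (M * T)"
proof -
  have step: "v s \<le> (v 0 + b * T) * exp (M * T)"
    if s: "s \<in> {0..T}" and below: "\<And>r. 0 < r \<Longrightarrow> r < s \<Longrightarrow> v r \<le> 1" for s
  proof -
    \<comment> \<open>Integrating factor; the term \<open>b * r\<close> absorbs the inhomogeneity
      because \<open>exp (- M * r) \<le> 1\<close>.\<close>
    let ?w = "\<lambda>r. v r * exp (- M * r) - b * r"
    have w: "(?w has_real_derivative (v' r - M * v r) * exp (- M * r) - b) (at r)" if "r \<in> {0..s}" for r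
    proof -
      have "(v has_real_derivative v' r) (at r)" using der that s by auto
      then show ?thesis by (auto intro!: derivative_eq_intros simp: algebra_simps)
    qed
    have "?w s \<le> ?w 0"
    proof (rule DERIV_nonpos_imp_decreasing_open[where f="?w" and a=0 and b=s])
      show "0 \<le> s" using s by simp
      show "continuous_on {0..s} ?w"
        using w by (meson DERIV_isCont continuous_at_imp_continuous_on)
      fix r assume r: "0 < r" "r < s"
      have "(v' r - M * v r) * exp (- M * r) \<le> b * exp (- M * r)"
        using le[of r] below[OF r] r s by (intro mult_right_mono) auto
      also have "\<dots> \<le> b" using b M r by (simp add: mult_left_le)
      finally show "\<exists>y. (?w has_real_derivative y) (at r) \<and> y \<le> 0"
        using w[of r] r by (intro exI conjI) auto
    qed
    then have "v s * exp (- M * s) \<le> v 0 + b * s" by simp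
    then have "v s \<le> (v 0 + b * s) * exp (M * s)"
      by (simp add: exp_minus field_simps)
    also have "\<dots> \<le> (v 0 + b * T) * exp (M * T)"
      using s M b v0 by (intro mult_mono) (auto intro: mult_left_mono)
    finally show ?thesis .
  qed
  have "v r < 1" if r: "r \<in> {0..T}" for r
  proof (rule ccontr)
    assume "\<not> v r < 1"
    have cont: "continuous_on {0..T} v"
      using der by (meson DERIV_isCont continuous_at_imp_continuous_on)
    \<comment> \<open>\<open>Inf S\<close> is the first time at which \<open>v\<close> reaches 1; up
      to there \<open>step\<close> applies and keeps \<open>v\<close> strictly below 1.\<close>
    define S where "S = {0..T} \<inter> v -` {1..}"
    have "closed S" unfolding S_def by (rule continuous_closed_preimage[OF cont]) auto
    moreover have "r \<in> S" using r \<open>\<not> v r < 1\<close> by (simp add: S_def)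
    moreover have bdd: "bdd_below S" by (auto simp: S_def)
    ultimately have InfS: "Inf S \<in> S" using closed_contains_Inf by blast
    have "v q \<le> 1" if "0 < q" "q < Inf S" for q
    proof -
      have "q \<notin> S" using that cInf_lower[OF _ bdd, of q] by auto
      then show ?thesis using that InfS by (auto simp: S_def)
    qed
    with step[of "Inf S"] InfS small show False by (auto simp: S_def)
  qed
  then show ?thesis using step[OF t] t by (simp add: less_imp_le)
qed

text \<open>The squared norm is differentiable also where \<open>f\<close> vanishes. The mixed term
  \<open>2 * norm (f t) * b\<close> is at most the sum of the two squares, whence the constants
  \<open>2 * L + 1\<close> and \<open>b\<^sup>2\<close>.\<close>

lemma gronwall_norm:
  fixes f :: "real \<Rightarrow> 'a::real_inner"
  assumes L: "L \<ge> 0" and b: "b \<ge> 0" and T: "T \<ge> 0"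
    and der: "\<And>t. t \<in> {0..T} \<Longrightarrow> (f has_vector_derivative f' t) (at t)"
    and le: "\<And>t. t \<in> {0..T} \<Longrightarrow> norm (f t) \<le> 1 \<Longrightarrow> norm (f' t) \<le> L * norm (f t) + b"
    and small: "((norm (f 0))\<^sup>2 + b\<^sup>2 * T) * exp ((2 * L + 1) * T) < 1" and t: "t \<in> {0..T}"
  shows "(norm (f t))\<^sup>2 \<le> ((norm (f 0))\<^sup>2 + b\<^sup>2 * T) * exp ((2 * L + 1) * T)"
proof (rule gronwall_below_1[where v="\<lambda>t. (norm (f t))\<^sup>2" and v'="\<lambda>t. 2 * (f t \<bullet> f' t)" and b="b\<^sup>2"])
  fix s assume s: "s \<in> {0..T}"
  have "((\<lambda>t. f t \<bullet> f t) has_derivative (\<lambda>h. f s \<bullet> (h *\<^sub>R f' s) + (h *\<^sub>R f' s) \<bullet> f s)) (at s)"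
    using has_derivative_inner[OF der[OF s, unfolded has_vector_derivative_def] der[OF s, unfolded has_vector_derivative_def]] .
  then show "((\<lambda>t. (norm (f t))\<^sup>2) has_real_derivative 2 * (f s \<bullet> f' s)) (at s)"
    unfolding has_field_derivative_def power2_norm_eq_inner
    by (rule has_derivative_eq_rhs) (auto simp: inner_commute)
  assume "(norm (f s))\<^sup>2 \<le> 1"
  then have 1: "norm (f' s) \<le> L * norm (f s) + b"
    using le[OF s] by (simp add: power_le_one_iff abs_square_le_1)
  have "2 * (f s \<bullet> f' s) \<le> 2 * (norm (f s) * norm (f' s))"
    using norm_cauchy_schwarz by simp
  also have "\<dots> \<le> 2 * (norm (f s) * (L * norm (f s) + b))"
    using 1 by (intro mult_left_mono) auto
  also have "\<dots> = 2 * L * (norm (f s))\<^sup>2 + 2 * norm (f s) * b"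
    by (simp add: algebra_simps power2_eq_square)
  also have "2 * norm (f s) * b \<le> (norm (f s))\<^sup>2 + b\<^sup>2"
    by (rule sum_squares_bound)
  finally show "2 * (f s \<bullet> f' s) \<le> (2 * L + 1) * (norm (f s))\<^sup>2 + b\<^sup>2"
    by (simp add: algebra_simps)
qed (use assms in auto)

lemma small_square_bound:
  fixes K e :: real
  assumes "K > 0" "e > 0"
  obtains d where "d > 0" "\<And>s. 0 \<le> s \<Longrightarrow> s < d \<Longrightarrow> s\<^sup>2 * K < e"
proof (rule that[of "min 1 (e / K)"])
  show "0 < min 1 (e / K)" using assms by simp
  fix s assume s: "0 \<le> s" "s < min 1 (e / K)"
  then have "s * s * K \<le> s * K" using assms by (intro mult_right_mono mult_left_le) auto
  also have "\<dots> < e" using s assms by (simp add: field_simps)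
  finally show "s\<^sup>2 * K < e" by (simp add: power2_eq_square)
qed

subsection \<open>Continuous dependence on the initial value\<close>

text \<open>Closed unit neighbourhood, in space, of the graph of \<open>x\<close> over [0,T],
  written as a continuous image so that compactness is immediate. The radius matches the level 1 in
  the Gronwall lemmas.\<close>

definition tube :: "(real \<Rightarrow> 'a::real_normed_vector) \<Rightarrow> real \<Rightarrow> (real \<times> 'a) set" where
  "tube x T = (\<lambda>(t, y). (t, x t + y)) ` ({0..T} \<times> cball 0 1)"

lemma compact_tube:
  fixes x :: "real \<Rightarrow> 'a::euclidean_space"
  assumes "continuous_on UNIV x"
  shows "compact (tube x T)"
  unfolding tube_def case_prod_beta
  by (intro compact_continuous_image compact_Times continuous_intros continuous_on_compose2[OF assms, of _ fst]) auto

lemma tubeI: "t \<in> {0..T} \<Longrightarrow> norm (p - x t) \<le> 1 \<Longrightarrow> (t, p) \<in> tube x T"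
  unfolding tube_def by (rule image_eqI[of _ _ "(t, p - x t)"]) auto

lemma has_vector_derivative_imp_continuous_on:
  assumes "\<And>t. (f has_vector_derivative f' t) (at t)"
  shows "continuous_on S f"
  by (rule continuous_at_imp_continuous_on) (use has_vector_derivative_continuous[OF assms] in simp)

lemma continuous_bounded_on_compact:
  fixes D :: "'a::topological_space \<Rightarrow> 'b::real_normed_vector"
  assumes "compact C" "continuous_on UNIV D"
  obtains L where "\<And>z. z \<in> C \<Longrightarrow> norm (D z) \<le> L" "L \<ge> 0"
proof -
  have "bounded (D ` C)"
    by (intro compact_imp_bounded compact_continuous_image continuous_on_subset[OF assms(2)] assms(1)) simp
  then obtain L where "L > 0" "\<And>w. w \<in> D ` C \<Longrightarrow> norm w \<le> L"
    unfolding bounded_pos by blast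
  then show ?thesis by (intro that[of L]) auto
qed

lemma has_derivative_space:
  assumes "((\<lambda>(t, x). \<psi> t x) has_derivative blinfun_apply (D (t, x))) (at (t, x))"
  shows "(\<psi> t has_derivative (\<lambda>h. D (t, x) (0, h))) (at x)"
proof -
  have "((\<lambda>x. (t, x)) has_derivative (\<lambda>h. (0, h))) (at x)"
    by (auto intro!: derivative_eq_intros)
  from has_derivative_compose[OF this, of "\<lambda>(t, x). \<psi> t x"] assms show ?thesis by simp
qed

lemma jacobian_space:
  fixes \<psi> :: "real \<Rightarrow> real^'n \<Rightarrow> real^'m"
  assumes "((\<lambda>(t, x). \<psi> t x) has_derivative blinfun_apply (D (t, x))) (at (t, x))"
  shows "jacobian (\<psi> t) (at x) *v h = D (t, x) (0, h)"
proof -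
  have d: "(\<psi> t has_derivative (\<lambda>h. D (t, x) (0, h))) (at x)"
    by (rule has_derivative_space) (rule assms)
  then have "(\<psi> t has_derivative (\<lambda>h. jacobian (\<psi> t) (at x) *v h)) (at x)"
    using jacobian_works by (auto simp: differentiable_def)
  from has_derivative_unique[OF d this] show ?thesis by metis
qed

lemma norm_blinfun_space_le: "norm (blinfun_apply B (0, h)) \<le> norm B * norm h"
  using norm_blinfun[of B "(0, h)"] by (simp add: norm_Pair)

text \<open>The derivative is bounded on the compact tube, so a Lipschitz estimate with constant
  \<open>L\<close> holds as long as the other solution stays within distance 1 of the reference
  solution: the conditional estimate that \<open>gronwall_norm\<close> takes.\<close>

lemma flow_continuous:
  fixes \<psi> :: "real \<Rightarrow> 'a::euclidean_space \<Rightarrow> 'a"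
  assumes der: "\<And>z. ((\<lambda>(t, x). \<psi> t x) has_derivative blinfun_apply (D z)) (at z)"
    and cont: "continuous_on UNIV D"
    and x: "\<And>\<xi>. x 0 \<xi> = \<xi>" "\<And>t \<xi>. ((\<lambda>t. x t \<xi>) has_vector_derivative \<psi> t (x t \<xi>)) (at t)"
    and T: "T \<ge> 0" and e: "e > 0"
  obtains d where "d > 0" "\<And>\<xi> t. norm (\<xi> - \<xi>0) < d \<Longrightarrow> t \<in> {0..T} \<Longrightarrow> norm (x t \<xi> - x t \<xi>0) < e"
proof -
  let ?C = "tube (\<lambda>t. x t \<xi>0) T"
  have "continuous_on UNIV (\<lambda>t. x t \<xi>0)"
    by (rule has_vector_derivative_imp_continuous_on) (rule x(2))
  then have "compact ?C" by (rule compact_tube)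
  then obtain L where L: "\<And>z. z \<in> ?C \<Longrightarrow> norm (D z) \<le> L" "L \<ge> 0"
    using continuous_bounded_on_compact[OF _ cont] by blast
  have lip: "norm (\<psi> t p - \<psi> t (x t \<xi>0)) \<le> L * norm (p - x t \<xi>0)" if t: "t \<in> {0..T}" and p: "norm (p - x t \<xi>0) \<le> 1" for t p
  proof (rule differentiable_bound[of "cball (x t \<xi>0) 1" "\<psi> t" "\<lambda>y h. D (t, y) (0, h)"])
    fix y assume y: "y \<in> cball (x t \<xi>0) 1"
    show "(\<psi> t has_derivative (\<lambda>h. D (t, y) (0, h))) (at y within cball (x t \<xi>0) 1)"
      by (rule has_derivative_at_withinI[OF has_derivative_space]) (rule der)
    have "(t, y) \<in> ?C" using y t by (intro tubeI) (auto simp: dist_norm norm_minus_commute)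
    then have "norm (D (t, y)) \<le> L" by (rule L)
    then show "onorm (\<lambda>h. D (t, y) (0, h)) \<le> L"
      by (intro onorm_le order.trans[OF norm_blinfun_space_le] mult_right_mono) auto
  qed (use p in \<open>auto simp: dist_norm norm_minus_commute\<close>)
  define K where "K = exp ((2 * L + 1) * T)"
  obtain d where d: "d > 0" "\<And>s. 0 \<le> s \<Longrightarrow> s < d \<Longrightarrow> s\<^sup>2 * K < min 1 (e\<^sup>2)"
    using small_square_bound[of K "min 1 (e\<^sup>2)"] e by (auto simp: K_def)
  show ?thesis
  proof (rule that[OF d(1)])
    fix \<xi> t assume \<xi>: "norm (\<xi> - \<xi>0) < d" and t: "t \<in> {0..T}"
    have small: "(norm (\<xi> - \<xi>0))\<^sup>2 * K < min 1 (e\<^sup>2)" by (rule d(2)) (use \<xi> in auto)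
    have "(norm (x t \<xi> - x t \<xi>0))\<^sup>2 \<le> ((norm (x 0 \<xi> - x 0 \<xi>0))\<^sup>2 + 0\<^sup>2 * T) * exp ((2 * L + 1) * T)"
      by (rule gronwall_norm[where f'="\<lambda>t. \<psi> t (x t \<xi>) - \<psi> t (x t \<xi>0)"])
        (use L(2) T t lip small in \<open>auto intro!: has_vector_derivative_diff x simp: x(1) K_def\<close>)
    with small have "(norm (x t \<xi> - x t \<xi>0))\<^sup>2 < e\<^sup>2" by (simp add: x(1) K_def)
    then show "norm (x t \<xi> - x t \<xi>0) < e" using e by (simp add: power_less_imp_less_base)
  qed
qed

text \<open>The difference of two solutions satisfies a linear inequality with a defect
  \<open>b\<close> caused by the different base solutions. Uniform continuity of \<open>q\<close>
  and \<open>D\<close> on the tube makes \<open>b\<close> small once the base solutions are close,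
  which \<open>flow_continuous\<close> provides.\<close>

lemma linearized_flow_continuous:
  fixes \<psi> :: "real \<Rightarrow> 'a::euclidean_space \<Rightarrow> 'a" and q :: "real \<times> 'a \<Rightarrow> 'a"
  assumes der: "\<And>z. ((\<lambda>(t, x). \<psi> t x) has_derivative blinfun_apply (D z)) (at z)"
    and cont: "continuous_on UNIV D" and q: "continuous_on UNIV q"
    and x: "\<And>\<xi>. x 0 \<xi> = \<xi>" "\<And>t \<xi>. ((\<lambda>t. x t \<xi>) has_vector_derivative \<psi> t (x t \<xi>)) (at t)"
    and y: "\<And>\<xi>. y 0 \<xi> = 0"
      "\<And>t \<xi>. ((\<lambda>t. y t \<xi>) has_vector_derivative (q (t, x t \<xi>) + D (t, x t \<xi>) (0, y t \<xi>))) (at t)"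
    and T: "T \<ge> 0"
  shows "continuous_on UNIV (\<lambda>\<xi>. y T \<xi>)"
  unfolding continuous_on_iff
proof (intro ballI allI impI)
  fix \<xi>0 and e :: real assume e: "e > 0"
  let ?C = "tube (\<lambda>t. x t \<xi>0) T"
  have "continuous_on UNIV (\<lambda>t. x t \<xi>0)"
    by (rule has_vector_derivative_imp_continuous_on) (rule x(2))
  then have C: "compact ?C" by (rule compact_tube)
  then obtain L where L: "\<And>z. z \<in> ?C \<Longrightarrow> norm (D z) \<le> L" "L \<ge> 0"
    using continuous_bounded_on_compact[OF _ cont] by blast
  have "continuous_on UNIV (\<lambda>t. y t \<xi>0)"
    by (rule has_vector_derivative_imp_continuous_on) (rule y(2))
  then obtain B where B: "\<And>t. t \<in> {0..T} \<Longrightarrow> norm (y t \<xi>0) \<le> B" "B \<ge> 0"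
    using continuous_bounded_on_compact[OF compact_Icc] by blast
  \<comment> \<open>\<open>T + 1\<close> instead of \<open>T\<close> keeps the constant positive
    also for \<open>T = 0\<close>.\<close>
  define K where "K = (T + 1) * exp ((2 * L + 1) * T)"
  have K: "K > 0" using T by (simp add: K_def)
  obtain b0 where b0: "b0 > 0" "\<And>s. 0 \<le> s \<Longrightarrow> s < b0 \<Longrightarrow> s\<^sup>2 * K < min 1 (e\<^sup>2)"
    using small_square_bound[of K "min 1 (e\<^sup>2)"] e K by auto
  define b where "b = b0 / 2"
  have b: "b > 0" "b\<^sup>2 * K < min 1 (e\<^sup>2)" using b0 by (auto simp: b_def)
  \<comment> \<open>The defect consists of the change of \<open>q\<close>, at most \<open>c\<close>,
    and of the change of \<open>D\<close> applied to the reference solution, at most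
    \<open>c * B\<close>; together these make \<open>b\<close>.\<close>
  define c where "c = b / (1 + B)"
  have "c * (1 + B) = b" using B(2) by (simp add: c_def)
  then have c: "c > 0" "c + c * B = b" using b B(2) by (auto simp: c_def ring_distribs)
  have uq: "uniformly_continuous_on ?C q" and uD: "uniformly_continuous_on ?C D"
    using C q cont by (auto intro!: compact_uniformly_continuous intro: continuous_on_subset)
  obtain d1 where d1: "d1 > 0" "\<And>z z'. z \<in> ?C \<Longrightarrow> z' \<in> ?C \<Longrightarrow> dist z' z < d1 \<Longrightarrow> dist (q z') (q z) < c"
    using uq c(1) unfolding uniformly_continuous_on_def by metis
  obtain d2 where d2: "d2 > 0" "\<And>z z'. z \<in> ?C \<Longrightarrow> z' \<in> ?C \<Longrightarrow> dist z' z < d2 \<Longrightarrow> dist (D z') (D z) < c"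
    using uD c(1) unfolding uniformly_continuous_on_def by metis
  have "min 1 (min d1 d2) > 0" using d1 d2 by simp
  then obtain d where d: "d > 0"
    "\<And>\<xi> t. norm (\<xi> - \<xi>0) < d \<Longrightarrow> t \<in> {0..T} \<Longrightarrow> norm (x t \<xi> - x t \<xi>0) < min 1 (min d1 d2)"
    using flow_continuous[OF der cont x T, of "min 1 (min d1 d2)" \<xi>0] by blast
  show "\<exists>d>0. \<forall>\<xi>\<in>UNIV. dist \<xi> \<xi>0 < d \<longrightarrow> dist (y T \<xi>) (y T \<xi>0) < e"
  proof (intro exI[of _ d] conjI ballI impI d(1))
    fix \<xi> assume "dist \<xi> \<xi>0 < d"
    then have \<xi>: "norm (\<xi> - \<xi>0) < d" by (simp add: dist_norm)
    let ?f = "\<lambda>t. y t \<xi> - y t \<xi>0"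
    let ?f' = "\<lambda>t. (q (t, x t \<xi>) + D (t, x t \<xi>) (0, y t \<xi>)) - (q (t, x t \<xi>0) + D (t, x t \<xi>0) (0, y t \<xi>0))"
    have bound: "norm (?f' t) \<le> L * norm (?f t) + b" if t: "t \<in> {0..T}" for t
    proof -
      let ?z = "(t, x t \<xi>)" and ?w = "(t, x t \<xi>0)"
      have xx: "norm (x t \<xi> - x t \<xi>0) < min 1 (min d1 d2)" by (rule d(2)[OF \<xi> t])
      have z: "?z \<in> ?C" "?w \<in> ?C"
        using tubeI[OF t, of "x t \<xi>" "\<lambda>t. x t \<xi>0"] tubeI[OF t, of "x t \<xi>0" "\<lambda>t. x t \<xi>0"] xx
        by simp_all
      have dz: "dist ?z ?w = norm (x t \<xi> - x t \<xi>0)" by (simp add: dist_Pair_Pair dist_norm)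
      have 1: "norm (q ?z - q ?w) \<le> c"
        using d1(2)[OF z(2,1)] xx dz by (simp add: dist_norm)
      have 2: "norm (D ?z - D ?w) \<le> c"
        using d2(2)[OF z(2,1)] xx dz by (simp add: dist_norm)
      have "D ?z (0, ?f t) = D ?z (0, y t \<xi>) - D ?z (0, y t \<xi>0)"
        using blinfun.diff_right[of "D ?z" "(0, y t \<xi>)" "(0, y t \<xi>0)"] by simp
      moreover have "(D ?z - D ?w) (0, y t \<xi>0) = D ?z (0, y t \<xi>0) - D ?w (0, y t \<xi>0)"
        by (rule blinfun.diff_left)
      \<comment> \<open>The increment of \<open>D\<close> is applied to the reference solution, for
        which the bound \<open>B\<close> is known; the middle term is linear in the
        difference.\<close>
      ultimately have eq: "?f' t = (q ?z - q ?w) + D ?z (0, ?f t) + (D ?z - D ?w) (0, y t \<xi>0)"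
        by (simp only:) (simp only: algebra_simps)
      have "norm (?f' t) \<le> norm (q ?z - q ?w) + norm (D ?z (0, ?f t)) + norm ((D ?z - D ?w) (0, y t \<xi>0))"
        unfolding eq by (rule norm_triangle_le[OF add_right_mono[OF norm_triangle_ineq]])
      moreover have "norm (D ?z (0, ?f t)) \<le> L * norm (?f t)"
        by (rule order.trans[OF norm_blinfun_space_le]) (intro mult_right_mono L z norm_ge_zero)
      moreover have "norm ((D ?z - D ?w) (0, y t \<xi>0)) \<le> c * B"
        by (rule order.trans[OF norm_blinfun_space_le]) (intro mult_mono 2 B t norm_ge_zero less_imp_le[OF c(1)])
      ultimately show ?thesis using 1 c(2) by linarith
    qed
    have small: "((norm (?f 0))\<^sup>2 + b\<^sup>2 * T) * exp ((2 * L + 1) * T) < min 1 (e\<^sup>2)"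
    proof -
      have "b\<^sup>2 * T * exp ((2 * L + 1) * T) \<le> b\<^sup>2 * K"
        unfolding K_def by (simp add: mult.assoc mult_left_mono algebra_simps)
      with b(2) show ?thesis by (simp add: y(1))
    qed
    have "(norm (?f T))\<^sup>2 \<le> ((norm (?f 0))\<^sup>2 + b\<^sup>2 * T) * exp ((2 * L + 1) * T)"
    proof (rule gronwall_norm[where f'="?f'"])
      show "(?f has_vector_derivative ?f' t) (at t)" for t
        by (intro has_vector_derivative_diff y)
    qed (use L(2) b T bound small in auto)
    with small have "(norm (?f T))\<^sup>2 < e\<^sup>2" by simp
    then show "dist (y T \<xi>) (y T \<xi>0) < e"
      using e by (simp add: power_less_imp_less_base dist_norm)
  qed
qed

lemma linear_ode_zero:
  fixes z :: "real \<Rightarrow> 'a::euclidean_space" and D :: "real \<times> 'a \<Rightarrow> (real \<times> 'a) \<Rightarrow>\<^sub>L 'a"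
  assumes cont: "continuous_on UNIV D" and x: "continuous_on UNIV x"
    and z: "z 0 = 0" "\<And>t. (z has_vector_derivative D (t, x t) (0, z t)) (at t)" and T: "T \<ge> 0"
  shows "z T = 0"
proof -
  let ?C = "tube x T"
  have "compact ?C" using x by (rule compact_tube)
  then obtain L where L: "\<And>z. z \<in> ?C \<Longrightarrow> norm (D z) \<le> L" "L \<ge> 0"
    using continuous_bounded_on_compact[OF _ cont] by blast
  have "(norm (z T))\<^sup>2 \<le> ((norm (z 0))\<^sup>2 + 0\<^sup>2 * T) * exp ((2 * L + 1) * T)"
  proof (rule gronwall_norm[where f'="\<lambda>t. D (t, x t) (0, z t)"])
    show "norm (D (t, x t) (0, z t)) \<le> L * norm (z t) + 0" if "t \<in> {0..T}" for t
    proof -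
      have "(t, x t) \<in> ?C" using that by (intro tubeI) auto
      then have "norm (D (t, x t)) \<le> L" by (rule L)
      then show ?thesis
        using order.trans[OF norm_blinfun_space_le[of "D (t, x t)" "z t"] mult_right_mono[of _ L "norm (z t)"]] by simp
    qed
  qed (use L(2) T z in auto)
  then show ?thesis by (simp add: z(1))
qed

section \<open>Affine dependence on \<open>lam\<close> and comparison of the degrees\<close>

theorem theorem2:
  fixes \<psi> \<phi>1 \<phi>2 :: "real \<Rightarrow> real^'n \<Rightarrow> real^'n"
    and \<Omega> :: "real \<Rightarrow> real \<Rightarrow> real^'n \<Rightarrow> real^'n"
    and \<eta> :: "real \<Rightarrow> real \<Rightarrow> real \<Rightarrow> real^'n \<Rightarrow> real^'n"
    and U :: "(real^'n) set" and T :: real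
  assumes T_pos: "T > 0"
    and \<psi>_C1: "C1_map (\<lambda>(t, x). \<psi> t x)"
    and \<psi>_per: "\<forall>t x. \<psi> (t + T) x = \<psi> t x"
    and \<Omega>_sol: "\<forall>t0 \<xi>. \<Omega> t0 t0 \<xi> = \<xi> \<and>
                   (\<forall>t. ((\<lambda>t. \<Omega> t t0 \<xi>) has_vector_derivative \<psi> t (\<Omega> t t0 \<xi>)) (at t))"
    and U_open: "open U" and U_bdd: "bounded U"
    and A0: "\<forall>\<xi>\<in>frontier U. \<Omega> T 0 \<xi> = \<xi>"
    and \<phi>1_C1: "C1_map (\<lambda>(t, x). \<phi>1 t x)" and \<phi>1_per: "\<forall>t x. \<phi>1 (t + T) x = \<phi>1 t x"
    and \<phi>2_C1: "C1_map (\<lambda>(t, x). \<phi>2 t x)" and \<phi>2_per: "\<forall>t x. \<phi>2 (t + T) x = \<phi>2 t x"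
    and \<eta>_sol: "\<forall>lam\<in>{0..1}. \<forall>s \<xi>. \<eta> lam s s \<xi> = 0 \<and>
                 (\<forall>t. ((\<lambda>t. \<eta> lam t s \<xi>) has_vector_derivative
                        (lam *\<^sub>R \<phi>1 t (\<Omega> t 0 \<xi>) + (1 - lam) *\<^sub>R \<phi>2 t (\<Omega> t 0 \<xi>)
                         + jacobian (\<psi> t) (at (\<Omega> t 0 \<xi>)) *v \<eta> lam t s \<xi>)) (at t))"
    and nonzero: "\<forall>lam\<in>{0..1}. \<forall>s\<in>{0..T}. \<forall>\<xi>\<in>frontier U. \<eta> lam T s \<xi> - \<eta> lam 0 s \<xi> \<noteq> 0"
  shows "brouwer_degree (\<lambda>\<xi>. \<eta> 1 T 0 \<xi>) U = brouwer_degree (\<lambda>\<xi>. \<eta> 0 T 0 \<xi>) U"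
proof -
  obtain D where D: "\<And>z. ((\<lambda>(t, x). \<psi> t x) has_derivative blinfun_apply (D z)) (at z)" "continuous_on UNIV D"
    using \<psi>_C1 unfolding C1_map_def by blast
  have cont: "continuous_on UNIV (\<lambda>(t, x). \<phi> t x)" if "C1_map (\<lambda>(t, x). \<phi> t x)" for \<phi> :: "real \<Rightarrow> real^'n \<Rightarrow> real^'n"
    using that has_derivative_continuous unfolding C1_map_def continuous_on_eq_continuous_at[OF open_UNIV] by blast
  define q where "q lam = (\<lambda>z. lam *\<^sub>R \<phi>1 (fst z) (snd z) + (1 - lam) *\<^sub>R \<phi>2 (fst z) (snd z))" for lam
  have q: "continuous_on UNIV (q lam)" for lam
    unfolding q_def using cont[OF \<phi>1_C1] cont[OF \<phi>2_C1] by (intro continuous_intros) (auto simp: case_prod_beta)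
  have x: "\<And>\<xi>. \<Omega> 0 0 \<xi> = \<xi>" "\<And>t \<xi>. ((\<lambda>t. \<Omega> t 0 \<xi>) has_vector_derivative \<psi> t (\<Omega> t 0 \<xi>)) (at t)"
    using \<Omega>_sol by auto
  have y0: "\<eta> lam 0 0 \<xi> = 0" if "lam \<in> {0..1}" for lam \<xi>
    using \<eta>_sol that by blast
  have y: "((\<lambda>t. \<eta> lam t 0 \<xi>) has_vector_derivative (q lam (t, \<Omega> t 0 \<xi>) + D (t, \<Omega> t 0 \<xi>) (0, \<eta> lam t 0 \<xi>))) (at t)"
    if "lam \<in> {0..1}" for lam t \<xi>
    using \<eta>_sol[rule_format, OF that, THEN conjunct2, rule_format, of 0 \<xi> t]
    by (simp add: jacobian_space[where D=D, OF D(1)] q_def)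
  have T: "T \<ge> 0" using T_pos by simp
  have cont_y: "continuous_on (closure U) (\<lambda>\<xi>. \<eta> lam T 0 \<xi>)" if "lam \<in> {0..1}" for lam
    using linearized_flow_continuous[OF D q x y0[OF that] y[OF that] T] continuous_on_subset by blast
  \<comment> \<open>The forcing \<open>q lam\<close> is affine in \<open>lam\<close>, so it cancels
    in the combination \<open>?z\<close>, which solves the homogeneous linear equation with initial
    value 0.\<close>
  have affine: "\<eta> lam T 0 \<xi> = (1 - lam) *\<^sub>R \<eta> 0 T 0 \<xi> + lam *\<^sub>R \<eta> 1 T 0 \<xi>" if lam: "lam \<in> {0..1}" for lam \<xi>
  proof -
    have x_cont: "continuous_on UNIV (\<lambda>t. \<Omega> t 0 \<xi>)"
      by (rule has_vector_derivative_imp_continuous_on) (rule x(2))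
    let ?z = "\<lambda>t. \<eta> lam t 0 \<xi> - ((1 - lam) *\<^sub>R \<eta> 0 t 0 \<xi> + lam *\<^sub>R \<eta> 1 t 0 \<xi>)"
    have "?z T = 0"
    proof (rule linear_ode_zero[OF D(2) x_cont _ _ T])
      show "?z 0 = 0" using lam by (simp add: y0)
      fix t
      let ?D = "\<lambda>v. D (t, \<Omega> t 0 \<xi>) (0, v)"
      have Dz: "?D (?z t) = ?D (\<eta> lam t 0 \<xi>) - ((1 - lam) *\<^sub>R ?D (\<eta> 0 t 0 \<xi>) + lam *\<^sub>R ?D (\<eta> 1 t 0 \<xi>))"
        by (simp flip: blinfun.add_right blinfun.scaleR_right blinfun.diff_right)
      have 01: "(0::real) \<in> {0..1}" "(1::real) \<in> {0..1}" by auto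
      show "(?z has_vector_derivative ?D (?z t)) (at t)"
        unfolding Dz
        by (rule has_vector_derivative_eq_rhs[OF has_vector_derivative_diff[OF y[OF lam]
              has_vector_derivative_add[OF bounded_linear.has_vector_derivative[OF bounded_linear_scaleR_right y[OF 01(1)]]
              bounded_linear.has_vector_derivative[OF bounded_linear_scaleR_right y[OF 01(2)]]]]])
          (simp add: q_def algebra_simps)
    qed
    then show ?thesis by simp
  qed
  have "brouwer_degree (\<lambda>\<xi>. \<eta> 0 T 0 \<xi>) U = brouwer_degree (\<lambda>\<xi>. \<eta> 1 T 0 \<xi>) U"
  proof (rule brouwer_degree_linear_homotopy[OF U_open U_bdd])
    fix \<xi> and lam :: real assume \<xi>: "\<xi> \<in> frontier U" and lam: "lam \<in> {0..1}"
    have "(0::real) \<in> {0..T}" using T by simp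
    then have "\<eta> lam T 0 \<xi> - \<eta> lam 0 0 \<xi> \<noteq> 0" using nonzero \<xi> lam by blast
    then show "(1 - lam) *\<^sub>R \<eta> 0 T 0 \<xi> + lam *\<^sub>R \<eta> 1 T 0 \<xi> \<noteq> 0"
      using affine[OF lam] y0[OF lam] by simp
  qed (auto intro: cont_y)
  then show ?thesis by simp
qed

end
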